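(* For every $\alpha,\gamma\in(0,1/4)$ there exists $n_0$ such that the following holds for every integer $n\ge n_0$. Let $H$ be a $3$-graph on $n$ vertices such that \[ e(H)\ge \max\left\{\binom{4\alpha n}{3},\ \binom{n}{3}-\binom{n-\alpha n}{3}\right\}+\gamma n^3. \] Then $H$ contains a $Y_{3,2}$-tiling covering more than $4\alpha n$ vertices.
   Context: A $3$-graph $H$ consists of a vertex set $V$ and an edge set $E\subseteq\binom{V}{3}$; $e(H)=|E|$. $Y_{3,2}$ is the $3$-graph consisting of two edges intersecting in exactly two vertices (so it has $4$ vertices). A $Y_{3,2}$-tiling of $H$ is a family of vertex-disjoint copies of $Y_{3,2}$ in $H$; it covers the vertices of all its copies. Binomial coefficients $\binom{x}{3}$ with non-integer $x$ denote $x(x-1)(x-2)/6$. *)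

theory Defs
  imports Complex_Main "HOL-Library.Disjoint_Sets"
begin

type_synonym 'a hypergraph = "'a set \<times> 'a set set"

abbreviation verts :: "'a hypergraph \<Rightarrow> 'a set" where
  "verts H \<equiv> fst H"

abbreviation edges :: "'a hypergraph \<Rightarrow> 'a set set" where
  "edges H \<equiv> snd H"

definition three_graph :: "'a hypergraph \<Rightarrow> bool" where
  "three_graph H \<longleftrightarrow> finite (verts H) \<and> (\<forall>e\<in>edges H. e \<subseteq> verts H \<and> card e = 3)"

definition subhypergraph :: "'a hypergraph \<Rightarrow> 'a hypergraph \<Rightarrow> bool" where
  "subhypergraph G H \<longleftrightarrow> verts G \<subseteq> verts H \<and> edges G \<subseteq> edges H"

text \<open>
  Being isomorphic to the fixed \<open>3\<close>-graph \<open>Y\<^sub>3\<^sub>,\<^sub>2\<close>. The two edges are automatically distinct,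
  since a \<open>3\<close>-set meets itself in three vertices.
\<close>

definition is_Y32 :: "'a hypergraph \<Rightarrow> bool" where
  "is_Y32 G \<longleftrightarrow> three_graph G \<and>
     (\<exists>e f. edges G = {e, f} \<and> card (e \<inter> f) = 2 \<and> verts G = e \<union> f)"

text \<open>Copies are subgraphs, not necessarily induced ones.\<close>

definition Y32_tiling :: "'a hypergraph \<Rightarrow> 'a hypergraph set \<Rightarrow> bool" where
  "Y32_tiling H T \<longleftrightarrow>
     (\<forall>G\<in>T. is_Y32 G \<and> subhypergraph G H) \<and> disjoint_family_on verts T"

definition covered :: "'a hypergraph set \<Rightarrow> 'a set" where
  "covered T = (\<Union>G\<in>T. verts G)"

end

theory Submission
  imports Defs "HOL-Library.FuncSet"
begin

text \<open>
  Take a tiling of maximal size \<open>k\<close> and suppose \<open>k \<le> \<alpha> n\<close>. Split the vertices into blocks of four, the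
  tiles being blocks, and the blocks into \<open>s\<close> intervals of equal length, tiles first. Choosing one block
  from each interval gives a pattern on \<open>4 s\<close> vertices, and by averaging a positive proportion of the
  choices gives one and the same dense pattern \<open>K\<close>. Erdos's theorem on complete multipartite
  subhypergraphs then yields a blow-up \<open>K(t)\<close> in \<open>H\<close> whose vertex classes fill whole blocks. A dense
  pattern has a large fractional tiling (in the sense of the homomorphic images of \<open>Y\<^sub>3\<^sub>,\<^sub>2\<close>, where an
  edge is used with one vertex doubled), so \<open>K(t)\<close> contains more tiles than the at most about
  \<open>4 \<alpha> s t\<close> old ones that it meets, contradicting maximality.

  The fractional statement is, in dual form, an inequality for independent random variables: if
  \<open>X, Y, Z\<close> are independent copies of a nonnegative variable of mean \<open>\<beta>\<close>, then
  \<open>X + Y + Z + min {X, Y, Z} \<ge> 1\<close> has probability at most \<open>max {64 \<beta>\<^sup>3, 1 - (1 - \<beta>)\<^sup>3}\<close>. By adding an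
  atom at \<open>0\<close> or at \<open>1\<close> this reduces to the single \<open>\<beta>\<close> at which both bounds agree, namely
  \<open>21 \<beta>\<^sup>2 + \<beta> = 1\<close>; there it follows by comparing several Markov type bounds that are cubic in
  \<open>P(X \<ge> 1/4)\<close>, \<open>E(X - 1/4)\<^sup>+\<close> and \<open>E(X; X < 1/4)\<close>.
\<close>

section \<open>The probability of a heavy triple\<close>

text \<open>The lightest tile on a triple doubles its lightest member; a triple is heavy when even
  this tile has weight at least 1.\<close>

definition heavy :: "real \<Rightarrow> real \<Rightarrow> real \<Rightarrow> bool" where
  "heavy x y z \<longleftrightarrow> 1 \<le> x + y + z + min x (min y z)"

definition heavy_prob :: "'i set \<Rightarrow> ('i \<Rightarrow> real) \<Rightarrow> ('i \<Rightarrow> real) \<Rightarrow> real" where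
  "heavy_prob I p w = (\<Sum>i\<in>I. \<Sum>j\<in>I. \<Sum>k\<in>I. p i * p j * p k * of_bool (heavy (w i) (w j) (w k)))"

lemma sum_triple_product:
  fixes p a b c :: "'i \<Rightarrow> real"
  shows "(\<Sum>i\<in>I. \<Sum>j\<in>I. \<Sum>k\<in>I. p i * p j * p k * (a i * b j * c k))
         = (\<Sum>i\<in>I. p i * a i) * (\<Sum>i\<in>I. p i * b i) * (\<Sum>i\<in>I. p i * c i)"
proof -
  have "(\<Sum>i\<in>I. \<Sum>j\<in>I. \<Sum>k\<in>I. p i * p j * p k * (a i * b j * c k))
     = (\<Sum>i\<in>I. \<Sum>j\<in>I. \<Sum>k\<in>I. (p i * a i) * ((p j * b j) * (p k * c k)))"
    by (simp add: mult_ac)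
  also have "\<dots> = (\<Sum>i\<in>I. (p i * a i) * (\<Sum>j\<in>I. (p j * b j) * (\<Sum>k\<in>I. p k * c k)))"
    by (simp only: sum_distrib_left)
  also have "\<dots> = (\<Sum>i\<in>I. p i * a i) * ((\<Sum>i\<in>I. p i * b i) * (\<Sum>i\<in>I. p i * c i))"
    by (simp only: sum_distrib_right)
  finally show ?thesis by (simp add: mult.assoc)
qed

text \<open>This treats a triple with exactly one big member: \<open>u\<close> is its excess
  \<open>4 * x - 1\<close>, and \<open>a\<close>, \<open>b\<close> are four times the other two
  values. The right side increases with \<open>u\<close>; for \<open>a \<le> b\<close> and the least
  admissible value \<open>u = 3 - 2 * a - b\<close> it exceeds 1 by
  \<open>(b - a) * (1 - b + 2 * a) / 6\<close>.\<close>

lemma one_big_bound: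
  fixes a b u :: real
  assumes "0 \<le> a" "0 \<le> b" "a \<le> 1" "b \<le> 1" "u + a + b + min a b \<ge> 3"
  shows "1 \<le> a * b + u / 3 * (1 + (a + b) / 2)"
proof -
  have *: "1 \<le> a * b + u / 3 * (1 + (a + b) / 2)"
    if "0 \<le> a" "a \<le> b" "b \<le> 1" "u + 2 * a + b \<ge> 3" for a b :: real
  proof -
    have "0 \<le> (b - a) * (1 - b + 2 * a)" using that by simp
    moreover have "0 \<le> (u - (3 - 2 * a - b)) * (2 + a + b)" using that by simp
    ultimately show ?thesis by (simp add: field_simps)
  qed
  show ?thesis
  proof (cases "a \<le> b")
    case True then show ?thesis using *[of a b] assms by simp
  next
    case False then show ?thesis using *[of b a] assms by (simp add: algebra_simps)
  qed
qed

section \<open>Pointwise bounds for heaviness by sums of products\<close>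

text \<open>
  All thresholds are in units of \<open>1/4\<close>. With \<open>W = 4 w\<close>, the functions below are \<open>1[W \<ge> 1]\<close>,
  \<open>1[W < 1]\<close>, \<open>(W - 1)\<^sup>+\<close>, \<open>(W - 3)\<^sup>+\<close> and \<open>W 1[W < 1]\<close>; every heavy triple has a big member.
\<close>

definition big :: "real \<Rightarrow> real" where "big x = of_bool (1 \<le> 4 * x)"
definition small :: "real \<Rightarrow> real" where "small x = of_bool (4 * x < 1)"
definition exc :: "real \<Rightarrow> real" where "exc x = max (4 * x - 1) 0"
definition top_exc :: "real \<Rightarrow> real" where "top_exc x = max (4 * x - 3) 0"
definition low :: "real \<Rightarrow> real" where "low x = (if 4 * x < 1 then 4 * x else 0)"

lemmas part_defs = big_def small_def exc_def top_exc_def low_def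

lemma heavy_bound0: "of_bool (heavy x y z) \<le> 1 - small x * small y * small z"
  by (auto simp: heavy_def small_def min_def)

lemma parts_nonneg:
  assumes "0 \<le> x" shows "0 \<le> big x" "0 \<le> small x" "0 \<le> exc x" "0 \<le> top_exc x" "0 \<le> low x"
  using assms by (auto simp: part_defs)

lemma parts_of_big: "1 \<le> 4 * x \<Longrightarrow> big x = 1 \<and> small x = 0 \<and> exc x = 4 * x - 1 \<and> low x = 0"
  and parts_of_small: "4 * x < 1 \<Longrightarrow> big x = 0 \<and> small x = 1 \<and> exc x = 0 \<and> top_exc x = 0 \<and> low x = 4 * x"
  by (auto simp: part_defs)

text \<open>Each summand is a product of functions of one variable, so its expectation over
  independent copies factorises. The products of \<open>big\<close> and \<open>small\<close> alone
  are exactly the indicator of at least two big members; the other terms come from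
  \<open>one_big_bound\<close> for a single big member.\<close>

lemma heavy_bound1:
  assumes "0 \<le> x" "0 \<le> y" "0 \<le> z"
  shows "of_bool (heavy x y z) \<le>
     big x * big y * big z
     + (big x * big y * small z + big x * small y * big z + small x * big y * big z)
     + (big x * low y * low z + low x * big y * low z + low x * low y * big z)
     + (exc x * small y * small z + small x * exc y * small z + small x * small y * exc z) / 3
     + (exc x * low y * small z + exc x * small y * low z + low x * exc y * small z
        + small x * exc y * low z + low x * small y * exc z + small x * low y * exc z) / 6"
    (is "_ \<le> ?R")
proof (cases "heavy x y z")
  case False
  have "0 \<le> ?R"
    by (intro add_nonneg_nonneg mult_nonneg_nonneg divide_nonneg_nonneg parts_nonneg assms) auto
  then show ?thesis using False by simp
next
  case True
  then have h: "1 \<le> x + y + z + min x (min y z)" by (simp add: heavy_def)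
  consider "4*x\<ge>1" "4*y\<ge>1" | "4*x\<ge>1" "4*z\<ge>1" | "4*y\<ge>1" "4*z\<ge>1" | "4*x<1" "4*y<1" "4*z<1"
    | "4*x\<ge>1" "4*y<1" "4*z<1" | "4*x<1" "4*y\<ge>1" "4*z<1" | "4*x<1" "4*y<1" "4*z\<ge>1"
    by linarith
  then have "1 \<le> ?R"
  proof cases
    case 1
    then show ?thesis using parts_of_big[of z] parts_of_small[of z] by (cases "1 \<le> 4 * z") (auto simp: parts_of_big)
  next
    case 2
    then show ?thesis using parts_of_big[of y] parts_of_small[of y] by (cases "1 \<le> 4 * y") (auto simp: parts_of_big)
  next
    case 3
    then show ?thesis using parts_of_big[of x] parts_of_small[of x] by (cases "1 \<le> 4 * x") (auto simp: parts_of_big)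
  next
    case 4 then show ?thesis using h by linarith
  next
    case 5
    then have "1 \<le> 4*y * (4*z) + (4*x-1) / 3 * (1 + (4*y + 4*z) / 2)"
      using assms h by (intro one_big_bound) (simp_all add: min_def split: if_splits)
    then show ?thesis using 5 by (simp add: parts_of_big parts_of_small field_simps)
  next
    case 6
    then have "1 \<le> 4*x * (4*z) + (4*y-1) / 3 * (1 + (4*x + 4*z) / 2)"
      using assms h by (intro one_big_bound) (simp_all add: min_def split: if_splits)
    then show ?thesis using 6 by (simp add: parts_of_big parts_of_small field_simps)
  next
    case 7
    then have "1 \<le> 4*x * (4*y) + (4*z-1) / 3 * (1 + (4*x + 4*y) / 2)"
      using assms h by (intro one_big_bound) (simp_all add: min_def split: if_splits)
    then show ?thesis using 7 by (simp add: parts_of_big parts_of_small field_simps)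
  qed
  then show ?thesis using True by simp
qed

text \<open>Refines \<open>heavy_bound1\<close> for exactly two big members: if \<open>x\<close>,
  \<open>y\<close> are big and \<open>z\<close> is small, heaviness means
  \<open>(exc x + exc y) / 2 + low z \<ge> 1\<close>, and this expression replaces the trivial bound
  1.\<close>

lemma heavy_bound2:
  assumes "0 \<le> x" "0 \<le> y" "0 \<le> z"
  shows "of_bool (heavy x y z) \<le>
     big x * big y * big z
     + (exc x * big y * small z + big x * exc y * small z + exc x * small y * big z
        + big x * small y * exc z + small x * exc y * big z + small x * big y * exc z) / 2
     + (big x * big y * low z + big x * low y * big z + low x * big y * big z)
     + (big x * low y * low z + low x * big y * low z + low x * low y * big z)
     + (exc x * small y * small z + small x * exc y * small z + small x * small y * exc z) / 3
     + (exc x * low y * small z + exc x * small y * low z + low x * exc y * small z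
        + small x * exc y * low z + low x * small y * exc z + small x * low y * exc z) / 6"
proof -
  consider "4*x\<ge>1" "4*y\<ge>1" "4*z\<ge>1"
    | "4*x\<ge>1" "4*y\<ge>1" "4*z<1"| "4*x\<ge>1" "4*y<1" "4*z\<ge>1" | "4*x<1" "4*y\<ge>1" "4*z\<ge>1"
    | "4*x<1 \<and> 4*y<1 \<or> 4*x<1 \<and> 4*z<1 \<or> 4*y<1 \<and> 4*z<1"
    by linarith
  then show ?thesis
  proof cases
    case 1 then show ?thesis by (simp add: parts_of_big parts_of_small)
  next
    case 2 then show ?thesis using assms by (simp add: parts_of_big parts_of_small) (auto simp: heavy_def field_simps)
  next
    case 3 then show ?thesis using assms by (simp add: parts_of_big parts_of_small) (auto simp: heavy_def field_simps)
  next
    case 4 then show ?thesis using assms by (simp add: parts_of_big parts_of_small) (auto simp: heavy_def field_simps)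
  next
    case 5
    then have X: "big x * big y * small z + big x * small y * big z + small x * big y * big z = 0"
      by (auto simp: parts_of_small)
    have "0 \<le> (exc x * big y * small z + big x * exc y * small z + exc x * small y * big z
        + big x * small y * exc z + small x * exc y * big z + small x * big y * exc z) / 2
     + (big x * big y * low z + big x * low y * big z + low x * big y * big z)"
      by (intro add_nonneg_nonneg mult_nonneg_nonneg divide_nonneg_nonneg parts_nonneg assms) auto
    then show ?thesis using X heavy_bound1[OF assms] by linarith
  qed
qed

text \<open>The function \<open>c\<close> is the excess cut off at 2, which is harmless for two big
  members because one excess of 2 already makes the average 1. For a single big member
  \<open>x\<close>, heaviness bounds \<open>top_exc x\<close> plus both small values plus their
  minimum below by 1; the minimum is at most the mean of the two, which gives the factor
  3/2.\<close>

lemma heavy_bound3: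
  assumes "0 \<le> x" "0 \<le> y" "0 \<le> z"
  defines "c \<equiv> \<lambda>x. exc x - top_exc x"
  shows "of_bool (heavy x y z) \<le>
     big x * big y * big z
     + (c x * big y * small z + big x * c y * small z + c x * small y * big z
        + big x * small y * c z + small x * c y * big z + small x * big y * c z) / 2
     + (big x * big y * low z + big x * low y * big z + low x * big y * big z)
     + (top_exc x * small y * small z + small x * top_exc y * small z + small x * small y * top_exc z)
     + (big x * low y * small z + big x * small y * low z + low x * big y * small z
        + small x * big y * low z + low x * small y * big z + small x * low y * big z) / (2 / 3)"
    (is "_ \<le> ?R")
proof (cases "heavy x y z")
  case False
  have c: "0 \<le> c x" if "0 \<le> x" for x using that by (simp add: c_def part_defs)
  have "0 \<le> ?R"
    by (intro add_nonneg_nonneg mult_nonneg_nonneg divide_nonneg_nonneg parts_nonneg c assms) auto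
  then show ?thesis using False by simp
next
  case True
  then have h: "1 \<le> x + y + z + min x (min y z)" by (simp add: heavy_def)
  have c: "c x = 4 * x - 1 - top_exc x" if "1 \<le> 4 * x" for x
    using that by (simp add: c_def part_defs)
  have c0: "c x = 0" if "4 * x < 1" for x
    using that by (simp add: c_def part_defs)
  consider "4*x\<ge>1" "4*y\<ge>1" "4*z\<ge>1"
    | "4*x\<ge>1" "4*y\<ge>1" "4*z<1"| "4*x\<ge>1" "4*y<1" "4*z\<ge>1" | "4*x<1" "4*y\<ge>1" "4*z\<ge>1"
    | "4*x<1" "4*y<1" "4*z<1"
    | "4*x\<ge>1" "4*y<1" "4*z<1" | "4*x<1" "4*y\<ge>1" "4*z<1" | "4*x<1" "4*y<1" "4*z\<ge>1"
    by linarith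
  then have "1 \<le> ?R"
  proof cases
    case 1 then show ?thesis by (simp add: parts_of_big)
  next
    case 2 then show ?thesis using h assms(1-3)
      by (simp add: parts_of_big parts_of_small c c0) (auto simp: top_exc_def max_def min_def field_simps split: if_splits)
  next
    case 3 then show ?thesis using h assms(1-3)
      by (simp add: parts_of_big parts_of_small c c0) (auto simp: top_exc_def max_def min_def field_simps split: if_splits)
  next
    case 4 then show ?thesis using h assms(1-3)
      by (simp add: parts_of_big parts_of_small c c0) (auto simp: top_exc_def max_def min_def field_simps split: if_splits)
  next
    case 5 then show ?thesis using h by linarith
  next
    case 6 then show ?thesis using h assms(1-3)
      by (simp add: parts_of_big parts_of_small c c0) (auto simp: top_exc_def max_def min_def field_simps split: if_splits)
  next
    case 7 then show ?thesis using h assms(1-3)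
      by (simp add: parts_of_big parts_of_small c c0) (auto simp: top_exc_def max_def min_def field_simps split: if_splits)
  next
    case 8 then show ?thesis using h assms(1-3)
      by (simp add: parts_of_big parts_of_small c c0) (auto simp: top_exc_def max_def min_def field_simps split: if_splits)
  qed
  then show ?thesis using True by simp
qed

section \<open>Cubic inequalities in the expectations\<close>

text \<open>
  In the following cubic inequalities, \<open>b\<close> is the critical mean, \<open>B = 4 b \<approx> 0.7828\<close>, and \<open>d\<close>, \<open>v\<close>,
  \<open>t\<close> stand for the expectations of \<^const>\<open>big\<close>, \<^const>\<open>low\<close> and \<^const>\<open>top_exc\<close>. The expectation
  of \<^const>\<open>exc\<close> is at most \<open>B - d - v\<close> and has been replaced by this value. The first inequality is
  sharp at \<open>d = b\<close>, \<open>v = 0\<close> (the star), the second one at \<open>d = B\<close> (the clique).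
\<close>

lemma numeric_case1:
  fixes b d v :: real
  assumes b: "21 * b^2 + b = 1" "0 < b" and d: "b \<le> d" "d \<le> 38/100" and v: "0 \<le> v"
    and side: "(4 * d - 1) * v \<le> (1 - d) * (1 - 4 * b)"
  shows "d^3 + 3 * d^2 * (1 - d) + 3 * d * v^2 + (4*b - d - v) * ((1-d)^2 + (1-d) * v) \<le> (4*b)^3"
proof -
  have b1: "b < 19571/100000"
  proof (rule ccontr)
    assume "\<not> ?thesis"
    then have "(19571/100000)^2 \<le> b^2" by (intro power_mono) auto
    then show False using b \<open>\<not> _\<close> by (simp add: power2_eq_square)
  qed
  have b2: "1957/10000 < b"
  proof (rule ccontr)
    assume "\<not> ?thesis"
    then have "b^2 \<le> (1957/10000)^2" using b by (intro power_mono) auto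
    then show False using b \<open>\<not> _\<close> by (simp add: power2_eq_square)
  qed
  \<comment> \<open>This is three times the defining equation of \<open>b\<close> multiplied by
    \<open>b\<close>. The right side equals \<open>1 - (1 - b)^3\<close>, so the two competing
    bounds coincide at the mean \<open>b\<close>.\<close>
  have b3: "(4*b)^3 = 3*b - 3*b^2 + b^3"
  proof -
    have "b * (21 * b^2 + b) = b" using b by simp
    then show ?thesis by (simp add: power2_eq_square power3_eq_cube algebra_simps)
  qed
  \<comment> \<open>Right side minus left side is \<open>v\<close> times the slack in
    \<open>side\<close>, so it is enough to treat \<open>v = 0\<close>.\<close>
  have *: "3 * d * v^2 + (4*b - d - v) * ((1-d)^2 + (1-d) * v) \<le> (4*b - d) * (1-d)^2"
  proof -
    have "0 \<le> v * ((1 - d) * (1 - 4 * b) - (4 * d - 1) * v)" using v side by simp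
    then show ?thesis by (simp add: power2_eq_square algebra_simps)
  qed
  \<comment> \<open>The quadratic decreases in \<open>d\<close> up to 38/100, so its value at 38/100
    decides.\<close>
  have "(1 + 3*b - b^2) - (5+b)*d + 3*d^2 \<ge> 0"
  proof -
    have "(38/100 - d) * (5 + b - 3 * (d + 38/100)) \<ge> 0"
      using d b1 b2 by (intro mult_nonneg_nonneg) auto
    moreover have "1 + 3*b - b^2 - (5+b)*(38/100) + 3*(38/100)^2 \<ge> 0"
    proof -
      have "b^2 = (1 - b) / 21" using b by simp
      moreover have "1 + 3*b - (1 - b) / 21 - (5+b)*(38/100) + 3*(38/100)^2 \<ge> 0"
        using b2 by (simp add: power2_eq_square field_simps)
      ultimately show ?thesis by linarith
    qed
    ultimately show ?thesis by (simp add: power2_eq_square field_simps)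
  qed
  \<comment> \<open>At \<open>v = 0\<close> the two sides agree for \<open>d = b\<close>; their
    difference is \<open>d - b\<close> times the quadratic above.\<close>
  then have "0 \<le> (d - b) * ((1 + 3*b - b^2) - (5+b)*d + 3*d^2)" using d by simp
  then have "d^3 + 3 * d^2 * (1 - d) + (4*b - d) * (1-d)^2 \<le> 3*b - 3*b^2 + b^3"
    by (simp add: power2_eq_square power3_eq_cube algebra_simps)
  with * b3 show ?thesis by linarith
qed

text \<open>Put \<open>m = B - d - v\<close>. The terms free of \<open>m\<close> fall short of
  \<open>(d + v)^3\<close> by \<open>v^3\<close>, and both \<open>B^3 - (d + v)^3\<close> and the
  remaining terms are multiples of \<open>m\<close>. The hypothesis \<open>side\<close> compares the
  two cofactors.\<close>

lemma numeric_case2: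
  fixes B d v :: real
  assumes B: "78/100 \<le> B" "d + v \<le> B" and d: "33/100 \<le> d" "d \<le> 1" and v: "0 \<le> v"
    and side: "(1 - d) * (1 + 2 * d + v) \<le> 3 * d^2 + 3 * d * (B - d + v) + ((B-d)^2 + (B-d)*v + v^2)"
  shows "d^3 + 3 * ((B - d - v) * d * (1-d) + d^2 * v) + 3 * d * v^2
    + (B - d - v) * ((1-d)^2 + (1-d) * v) \<le> B^3"
proof -
  have "0 \<le> (B - d - v) * (3 * d^2 + 3 * d * (B - d + v) + ((B-d)^2 + (B-d)*v + v^2)
     - (1 - d) * (1 + 2 * d + v))" using side B by simp
  moreover have "0 \<le> v^3" using v by simp
  ultimately show ?thesis by (simp add: power2_eq_square power3_eq_cube algebra_simps)
qed

text \<open>Provides the hypothesis \<open>side\<close> of \<open>numeric_case2\<close> on three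
  regions of the \<open>(d, v)\<close> plane.\<close>

lemma numeric_side2:
  fixes B d v :: real
  assumes B: "7828/10000 \<le> B" and v: "0 \<le> v"
    and c: "33/100 \<le> d \<and> 2/10 \<le> v \<or> 38/100 \<le> d \<and> 4/100 \<le> v \<or> 4/10 \<le> d"
  shows "(1 - d) * (1 + 2 * d + v) \<le> 3 * d^2 + 3 * d * (B - d + v) + ((B-d)^2 + (B-d)*v + v^2)"
proof -
  have d0: "33/100 \<le> d" using c by auto
  define C where "C = (7828/10000 :: real)"
  have mono: "C * (C + d + v) \<le> B * (B + d + v)"
    using B d0 v by (intro mult_mono) (auto simp: C_def)
  have "C * (C + d + v) + 3 * d^2 - d - 1 + v * (3*d - 1) + v^2 \<ge> 0"
  proof -
    \<comment> \<open>The two linear conditions make the expression nondecreasing in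
      \<open>d\<close> and \<open>v\<close> from the corner \<open>(d0, v0)\<close> on, so each
      region is checked at its lower left corner only.\<close>
    have *: ?thesis if "d0 \<le> d" "v0 \<le> v" "0 \<le> v0" "3 * d0 + C + 2 * v0 \<ge> 1" "6 * d0 + C \<ge> 1"
      "C * (C + d0 + v0) + 3 * d0^2 - d0 - 1 + v0 * (3*d0 - 1) + v0^2 \<ge> 0" for d0 v0
    proof -
      have "0 \<le> (d - d0) * (6 * d0 + C - 1)" "0 \<le> (v - v0) * (3 * d0 + C + 2 * v0 - 1)"
        "0 \<le> (d - d0)^2" "0 \<le> (v - v0)^2" "0 \<le> (d - d0) * v"
        using that v by simp_all
      then show ?thesis using that(6) by (simp add: power2_eq_square algebra_simps)
    qed
    from c show ?thesis
    proof (elim disjE conjE)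
      assume "33/100 \<le> d" "2/10 \<le> v"
      then show ?thesis by (rule *) (simp_all add: C_def power2_eq_square)
    next
      assume "38/100 \<le> d" "4/100 \<le> v"
      then show ?thesis by (rule *) (simp_all add: C_def power2_eq_square)
    next
      assume "4/10 \<le> d"
      then show ?thesis using v by (rule *) (simp_all add: C_def power2_eq_square)
    qed
  qed
  with mono show ?thesis
    by (simp add: power2_eq_square algebra_simps)
qed

text \<open>Covers the small window of \<open>(d, v)\<close> where neither of the two preceding
  estimates is available.\<close>

lemma numeric_case3:
  fixes B d v t :: real
  assumes B: "7828/10000 \<le> B" "B \<le> 7829/10000" and d: "38/100 \<le> d" "d \<le> 4/10" and v: "0 \<le> v" "v \<le> 4/100"
    and t: "3 * t \<le> B - d - v"
  shows "d^3 + 3 * ((B - d - v - t) * d * (1-d) + d^2 * v) + 3 * t * (1-d)^2 + 9 * d * v * (1-d) \<le> B^3"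
proof -
  \<comment> \<open>The coefficient of \<open>t\<close> is
    \<open>3 * (1 - d) * (1 - 2 * d) \<ge> 0\<close>, so \<open>t\<close> may be raised to its
    largest value \<open>(B - d - v) / 3\<close>.\<close>
  have "0 \<le> (B - d - v - 3 * t) * ((1 - d) * (1 - 2 * d))"
    using d t by simp
  then have "d^3 + 3 * ((B - d - v - t) * d * (1-d) + d^2 * v) + 3 * t * (1-d)^2 + 9 * d * v * (1-d)
    \<le> 2 * d^3 + B - d - B * d^2 + v * (9 * d - 5 * d^2 - 1)"
    by (simp add: power2_eq_square power3_eq_cube algebra_simps)
  also have "v * (9 * d - 5 * d^2 - 1) \<le> 4/100 * (18/10)"
  proof (rule mult_mono)
    have "0 \<le> (4/10 - d) * (9 - 5 * (d + 4/10))" using d by simp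
    then show "9 * d - 5 * d^2 - 1 \<le> 18/10" by (simp add: power2_eq_square algebra_simps)
    have "0 \<le> d * (9 - 5 * d) - 1"
    proof -
      have "38/100 * 7 \<le> d * (9 - 5 * d)" using d by (intro mult_mono) auto
      then show ?thesis by simp
    qed
    then show "0 \<le> 9 * d - 5 * d^2 - 1" by (simp add: power2_eq_square algebra_simps)
  qed (use v in auto)
  also have "2 * d^3 + B - d - B * d^2 \<le> 4058/10000"
  proof -
    have "d^2 * d \<le> d^2 * (4/10)" using d by (intro mult_left_mono) auto
    then have "2 * d^3 \<le> 8/10 * d^2" by (simp add: power2_eq_square power3_eq_cube)
    moreover have "d^2 * (8/10 - B) \<le> (4/10)^2 * (8/10 - 7828/10000)"
      using d B by (intro mult_mono power_mono) auto
    then have "8/10 * d^2 - B * d^2 \<le> 2752/1000000" by (simp add: power2_eq_square algebra_simps)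
    ultimately show ?thesis using B d by linarith
  qed
  also have "4058/10000 + 4/100 * (18/10) \<le> (7828/10000 :: real)^3" by (simp add: power3_eq_cube)
  also have "\<dots> \<le> B^3" using B by (intro power_mono) auto
  finally show ?thesis by simp
qed

section \<open>The bound at the critical mean\<close>

definition wmean :: "'i set \<Rightarrow> ('i \<Rightarrow> real) \<Rightarrow> ('i \<Rightarrow> real) \<Rightarrow> real" where
  "wmean I p f = (\<Sum>i\<in>I. p i * f i)"

lemma wmean_mono:
  assumes "\<And>i. i \<in> I \<Longrightarrow> 0 \<le> p i" "\<And>i. i \<in> I \<Longrightarrow> f i \<le> g i"
  shows "wmean I p f \<le> wmean I p g"
  unfolding wmean_def using assms by (intro sum_mono mult_left_mono) auto

lemma wmean_nonneg:
  assumes "\<And>i. i \<in> I \<Longrightarrow> 0 \<le> p i" "\<And>i. i \<in> I \<Longrightarrow> 0 \<le> f i"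
  shows "0 \<le> wmean I p f"
  unfolding wmean_def using assms by (intro sum_nonneg) auto

lemma heavy_prob_le:
  fixes F :: "'i \<Rightarrow> 'i \<Rightarrow> 'i \<Rightarrow> real"
  assumes "\<And>i. i \<in> I \<Longrightarrow> 0 \<le> p i"
    and "\<And>i j k. \<lbrakk>i \<in> I; j \<in> I; k \<in> I\<rbrakk> \<Longrightarrow> of_bool (heavy (w i) (w j) (w k)) \<le> F i j k"
  shows "heavy_prob I p w \<le> (\<Sum>i\<in>I. \<Sum>j\<in>I. \<Sum>k\<in>I. p i * p j * p k * F i j k)"
  unfolding heavy_prob_def using assms by (intro sum_mono mult_left_mono) auto

text \<open>The pointwise bounds are integrated and the best one is chosen according to
  \<open>d\<close> and \<open>v\<close>. For \<open>d \<le> b\<close> the absence of heavy triples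
  of small members suffices. Bound 1 serves for \<open>d\<close> up to 33/100, and up to 38/100
  while \<open>v \<le> 2/10\<close>. Bound 2 serves for larger \<open>v\<close> there, and beyond
  38/100 unless \<open>d < 4/10\<close> and \<open>v < 4/100\<close>; bound 3 fills this
  gap.\<close>

lemma heavy_prob_critical:
  assumes "finite I" and p: "\<And>i. i \<in> I \<Longrightarrow> 0 \<le> p i" and p1: "sum p I = 1"
    and w: "\<And>i. i \<in> I \<Longrightarrow> 0 \<le> w i" "\<And>i. i \<in> I \<Longrightarrow> w i \<le> 1" and mean: "wmean I p w \<le> b"
    and b: "21 * b^2 + b = 1" "0 < b"
  shows "heavy_prob I p w \<le> 1 - (1 - b)^3"
proof -
  define d N m v t where "d = wmean I p (\<lambda>i. big (w i))" and "N = wmean I p (\<lambda>i. small (w i))"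
    and "m = wmean I p (\<lambda>i. exc (w i))" and "v = wmean I p (\<lambda>i. low (w i))"
    and "t = wmean I p (\<lambda>i. top_exc (w i))"
  note defs = d_def N_def m_def v_def t_def
  have nn: "0 \<le> d" "0 \<le> N" "0 \<le> m" "0 \<le> v" "0 \<le> t"
    unfolding defs by (intro wmean_nonneg p parts_nonneg w; assumption)+
  have dN: "N = 1 - d"
  proof -
    have "d + N = wmean I p (\<lambda>i. 1)"
      unfolding d_def N_def wmean_def sum.distrib[symmetric]
      by (intro sum.cong) (auto simp: big_def small_def)
    then show ?thesis by (simp add: wmean_def p1)
  qed
  have total: "d + m + v \<le> 4 * b"
  proof -
    have "d + m + v = wmean I p (\<lambda>i. 4 * w i)"
      unfolding d_def m_def v_def wmean_def sum.distrib[symmetric]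
      by (intro sum.cong) (auto simp: part_defs algebra_simps)
    also have "\<dots> = 4 * wmean I p w" by (simp add: wmean_def sum_distrib_left mult_ac)
    finally show ?thesis using mean by simp
  qed
  \<comment> \<open>Since \<open>w i \<le> 1\<close>, an excess over 3 in the scaled variable is at
    most a third of the excess over 1.\<close>
  have tm: "3 * t \<le> m"
  proof -
    have "3 * t = wmean I p (\<lambda>i. 3 * top_exc (w i))" by (simp add: t_def wmean_def sum_distrib_left mult_ac)
    also have "\<dots> \<le> m"
      unfolding m_def
    proof (intro wmean_mono p)
      show "3 * top_exc (w i) \<le> exc (w i)" if "i \<in> I" for i
        using w(2)[OF that] by (simp add: top_exc_def exc_def max_def)
    qed
    finally show ?thesis .
  qed
  have d1: "d \<le> 1" using dN nn by simp
  have triple: "(\<Sum>i\<in>I. \<Sum>j\<in>I. \<Sum>k\<in>I. p i * p j * p k * (f (w i) * g (w j) * h (w k)))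
    = wmean I p (\<lambda>i. f (w i)) * wmean I p (\<lambda>i. g (w i)) * wmean I p (\<lambda>i. h (w i))" for f g h
    using sum_triple_product[of p "\<lambda>i. f (w i)" "\<lambda>i. g (w i)" "\<lambda>i. h (w i)" I] by (simp add: wmean_def)
  note heavy_le = heavy_prob_le[where I = I and p = p and w = w, OF p]
  note expand = distrib_left right_diff_distrib times_divide_eq_right sum.distrib sum_subtractf sum_divide_distrib[symmetric]
  have Q0: "heavy_prob I p w \<le> 1 - (1 - d)^3"
  proof -
    have one: "(\<Sum>i\<in>I. \<Sum>j\<in>I. \<Sum>k\<in>I. p i * p j * p k) = 1"
      using sum_triple_product[of p "\<lambda>_. 1" "\<lambda>_. 1" "\<lambda>_. 1" I] by (simp add: p1)
    have "heavy_prob I p w \<le> (\<Sum>i\<in>I. \<Sum>j\<in>I. \<Sum>k\<in>I. p i * p j * p k *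
       (1 - small (w i) * small (w j) * small (w k)))"
      by (rule heavy_le) (use heavy_bound0 in auto)
    also have "\<dots> = 1 - N^3"
      unfolding expand triple by (simp add: one N_def power3_eq_cube)
    finally show ?thesis by (simp add: dN)
  qed
  have Q1: "heavy_prob I p w \<le> d^3 + 3 * d^2 * (1 - d) + 3 * d * v^2 + m * ((1-d)^2 + (1-d) * v)"
    by (rule order_trans[OF heavy_le[OF _ heavy_bound1[OF w(1) w(1) w(1)]]], assumption+)
      (unfold expand triple defs[symmetric] dN,
       simp add: power2_eq_square power3_eq_cube field_simps)
  have Q2: "heavy_prob I p w \<le> d^3 + 3 * (m * d * (1-d) + d^2 * v) + 3 * d * v^2 + m * ((1-d)^2 + (1-d) * v)"
    by (rule order_trans[OF heavy_le[OF _ heavy_bound2[OF w(1) w(1) w(1)]]], assumption+)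
      (unfold expand triple defs[symmetric] dN,
       simp add: power2_eq_square power3_eq_cube field_simps)
  have c: "wmean I p (\<lambda>i. exc (w i) - top_exc (w i)) = m - t"
    by (simp add: m_def t_def wmean_def right_diff_distrib sum_subtractf)
  have Q3: "heavy_prob I p w \<le> d^3 + 3 * ((m - t) * d * (1-d) + d^2 * v) + 3 * t * (1-d)^2 + 9 * d * v * (1-d)"
    by (rule order_trans[OF heavy_le[OF _ heavy_bound3[OF w(1) w(1) w(1)]]], assumption+)
      (unfold distrib_left times_divide_eq_right sum.distrib
        sum_divide_distrib[symmetric] triple[where f = "\<lambda>x. exc x - top_exc x"]
        triple[where g = "\<lambda>x. exc x - top_exc x"] triple[where h = "\<lambda>x. exc x - top_exc x"] triple defs[symmetric] dN c,
       simp add: power2_eq_square power3_eq_cube field_simps)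
  have b3: "(4*b)^3 = 1 - (1 - b)^3"
  proof -
    have "b * (21 * b^2 + b) = b" using b by simp
    then show ?thesis by (simp add: power2_eq_square power3_eq_cube algebra_simps)
  qed
  have B: "7828/10000 \<le> 4 * b" "4 * b \<le> 7829/10000"
  proof -
    show "7828/10000 \<le> 4 * b"
    proof (rule ccontr)
      assume *: "\<not> ?thesis"
      then have "b^2 \<le> (1957/10000)^2" using b by (intro power_mono) auto
      then show False using b * by (simp add: power2_eq_square)
    qed
    show "4 * b \<le> 7829/10000"
    proof (rule ccontr)
      assume *: "\<not> ?thesis"
      then have "(19572/100000)^2 \<le> b^2" by (intro power_mono) auto
      then show False using b * by (simp add: power2_eq_square)
    qed
  qed
  have m: "m \<le> 4 * b - d - v" using total by simp
  have "v \<le> 4 * b - d" using total nn by simp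
  have case1: ?thesis if "b \<le> d" "d \<le> 38/100" "(4 * d - 1) * v \<le> (1 - d) * (1 - 4 * b)"
  proof -
    have "m * ((1-d)^2 + (1-d) * v) \<le> (4 * b - d - v) * ((1-d)^2 + (1-d) * v)"
      using m d1 nn by (intro mult_right_mono) auto
    with Q1 numeric_case1[OF b that(1,2) nn(4) that(3)] b3 show ?thesis by linarith
  qed
  have case2: ?thesis if "33/100 \<le> d \<and> 2/10 \<le> v \<or> 38/100 \<le> d \<and> 4/100 \<le> v \<or> 4/10 \<le> d"
  proof -
    have "m * ((1-d)^2 + (1-d) * v) \<le> (4 * b - d - v) * ((1-d)^2 + (1-d) * v)"
      using m d1 nn by (intro mult_right_mono) auto
    moreover have "m * d * (1-d) \<le> (4 * b - d - v) * d * (1-d)"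
      using m d1 nn by (intro mult_right_mono) auto
    moreover have "d^3 + 3 * ((4 * b - d - v) * d * (1-d) + d^2 * v) + 3 * d * v^2
      + (4 * b - d - v) * ((1-d)^2 + (1-d) * v) \<le> (4 * b)^3"
    proof (rule numeric_case2)
      show "(1 - d) * (1 + 2 * d + v) \<le> 3 * d^2 + 3 * d * (4 * b - d + v) + ((4 * b-d)^2 + (4 * b-d)*v + v^2)"
        using B nn total that by (intro numeric_side2) auto
    qed (use B nn total that d1 in auto)
    ultimately show ?thesis using Q2 b3 by (simp add: distrib_left)
  qed
  have case3: ?thesis if "38/100 \<le> d" "d \<le> 4/10" "v \<le> 4/100"
  proof -
    have "(m - t) * d * (1-d) \<le> (4 * b - d - v - t) * d * (1-d)"
      using m d1 nn by (intro mult_right_mono) auto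
    moreover have "d^3 + 3 * ((4 * b - d - v - t) * d * (1-d) + d^2 * v) + 3 * t * (1-d)^2 + 9 * d * v * (1-d) \<le> (4 * b)^3"
      by (rule numeric_case3) (use that B nn m tm in auto)
    ultimately show ?thesis using Q3 b3 by (simp add: distrib_left)
  qed
  show ?thesis
  proof (cases "d \<le> b")
    case True
    then have "(1 - b)^3 \<le> (1 - d)^3" using B by (intro power_mono) auto
    with Q0 show ?thesis by simp
  next
    case False
    then have db: "b \<le> d" by simp
    show ?thesis
    proof (cases "d \<le> 33/100")
      case d33: True
      show ?thesis
      proof (rule case1[OF db])
        have "(4 * d - 1) * v \<le> (1 - d) * (1 - 4 * b)"
        proof (cases "4 * d \<le> 1")
          case True
          then have "(4 * d - 1) * v \<le> 0" using nn by (simp add: mult_nonpos_nonneg)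
          also have "0 \<le> (1 - d) * (1 - 4 * b)" using d1 B by simp
          finally show ?thesis .
        next
          case False
          have "(4 * d - 1) * v \<le> (4 * d - 1) * (4 * b - d)"
            using False \<open>v \<le> _\<close> by (intro mult_left_mono) auto
          also have "\<dots> \<le> (1 - d) * (1 - 4 * b)"
          proof -
            have "0 \<le> (33/100 - d) * (2 + 3 * (4 * b) - 4 * (d + 33/100))" using d33 B by simp
            then show ?thesis using B by (simp add: field_simps)
          qed
          finally show ?thesis .
        qed
        then show "(4 * d - 1) * v \<le> (1 - d) * (1 - 4 * b)" .
      qed (use d33 in auto)
    next
      case d33: False
      show ?thesis
      proof (cases "d \<le> 38/100")
        case True
        show ?thesis
        proof (cases "v \<le> 2/10")
          case v: True
          have "(4 * d - 1) * v \<le> (52/100) * (2/10)"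
            using True d33 nn v by (intro mult_mono) auto
          also have "\<dots> \<le> (62/100) * (2171/10000)" by simp
          also have "\<dots> \<le> (1 - d) * (1 - 4 * b)" using True B by (intro mult_mono) auto
          finally show ?thesis using case1 db True by blast
        next
          case False
          then show ?thesis using d33 by (intro case2) auto
        qed
      next
        case False
        then show ?thesis using case2 case3 by (cases "d \<le> 4/10"; cases "v \<le> 4/100") auto
      qed
    qed
  qed
qed

lemma critical_root_exists: "\<exists>b::real. 21 * b^2 + b = 1 \<and> 0 < b \<and> b < 1"
proof (intro exI conjI)
  let ?b = "(sqrt 85 - 1) / 42"
  have s: "1 < sqrt 85" "sqrt 85 < 43" by (auto simp: real_less_rsqrt real_less_lsqrt)
  show "21 * ?b^2 + ?b = 1" by (simp add: power2_eq_square field_simps)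
  show "0 < ?b" "?b < 1" using s by auto
qed

section \<open>Reduction of an arbitrary mean to the critical one\<close>

lemma heavy_prob_mono:
  assumes "\<And>i. i \<in> I \<Longrightarrow> 0 \<le> p i"
    and "\<And>i j k. \<lbrakk>i \<in> I; j \<in> I; k \<in> I; heavy (w i) (w j) (w k)\<rbrakk> \<Longrightarrow> heavy (w' i) (w' j) (w' k)"
  shows "heavy_prob I p w \<le> heavy_prob I p w'"
  unfolding heavy_prob_def using assms by (intro sum_mono mult_left_mono) auto

text \<open>A member of value at least 1 is capped to 1, which alone makes the triple heavy; without
  such a member nothing changes. Hence values may be assumed to be at most 1.\<close>

lemma heavy_cap:
  assumes "0 \<le> x" "0 \<le> y" "0 \<le> z" "heavy x y z"
  shows "heavy (min x 1) (min y 1) (min z 1)"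
  using assms by (auto simp: heavy_def min_def split: if_splits)

lemma heavy_if_one: "\<lbrakk>0 \<le> x; 0 \<le> y; 0 \<le> z; x = 1 \<or> y = 1 \<or> z = 1\<rbrakk> \<Longrightarrow> heavy x y z"
  by (auto simp: heavy_def min_def)

lemma heavy_prob_complement:
  assumes "sum p I = 1"
  shows "1 - heavy_prob I p w
    = (\<Sum>i\<in>I. \<Sum>j\<in>I. \<Sum>k\<in>I. p i * p j * p k * of_bool (\<not> heavy (w i) (w j) (w k)))"
proof -
  have "(\<Sum>i\<in>I. \<Sum>j\<in>I. \<Sum>k\<in>I. p i * p j * p k) = 1"
    using sum_triple_product[of p "\<lambda>_. 1" "\<lambda>_. 1" "\<lambda>_. 1" I] by (simp add: assms)
  moreover have "p i * p j * p k * of_bool (\<not> heavy (w i) (w j) (w k))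
      = p i * p j * p k - p i * p j * p k * of_bool (heavy (w i) (w j) (w k))" for i j k
    by (simp add: of_bool_def)
  ultimately show ?thesis by (simp add: heavy_prob_def sum_subtractf)
qed

text \<open>Adding an atom of weight \<open>c\<close>; \<open>c = 0\<close> dilutes the distribution and \<open>c = 1\<close> enlarges the star.\<close>

definition mix_p :: "real \<Rightarrow> ('i \<Rightarrow> real) \<Rightarrow> 'i option \<Rightarrow> real" where
  "mix_p s p = case_option (1 - s) (\<lambda>i. s * p i)"

abbreviation mix_I :: "'i set \<Rightarrow> 'i option set" where
  "mix_I I \<equiv> insert None (Some ` I)"

lemma sum_mix_I:
  assumes "finite I"
  shows "(\<Sum>x\<in>mix_I I. f x) = f None + (\<Sum>i\<in>I. f (Some i))"
  using assms by (subst sum.insert) (auto simp: sum.reindex)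

lemma sum_mix_p: "finite I \<Longrightarrow> sum p I = 1 \<Longrightarrow> sum (mix_p s p) (mix_I I) = 1"
  by (simp only: sum_mix_I mix_p_def) (simp add: sum_distrib_left[symmetric])

lemma heavy_prob_critical_mix:
  assumes I: "finite I" and p: "\<And>i. i \<in> I \<Longrightarrow> 0 \<le> p i" and p1: "sum p I = 1"
    and w: "\<And>i. i \<in> I \<Longrightarrow> 0 \<le> w i" "\<And>i. i \<in> I \<Longrightarrow> w i \<le> 1"
    and s: "0 \<le> s" "s \<le> 1" and c: "0 \<le> c" "c \<le> 1" and mean: "(1 - s) * c + s * wmean I p w \<le> b"
    and b: "21 * b^2 + b = 1" "0 < b"
  shows "heavy_prob (mix_I I) (mix_p s p) (case_option c w) \<le> 1 - (1 - b)^3"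
proof (rule heavy_prob_critical[OF _ _ sum_mix_p[OF I p1] _ _ _ b])
  have "wmean (mix_I I) (mix_p s p) (case_option c w) = (1 - s) * c + s * wmean I p w"
    by (simp only: wmean_def sum_mix_I[OF I] mix_p_def) (simp add: sum_distrib_left mult_ac)
  then show "wmean (mix_I I) (mix_p s p) (case_option c w) \<le> b" using mean by simp
qed (use I p w s c in \<open>auto simp: mix_p_def\<close>)

text \<open>Only the triples that avoid the new atom are kept; their weights are scaled by
  \<open>s^3\<close>.\<close>

lemma heavy_prob_mix_ge:
  assumes I: "finite I" and p: "\<And>i. i \<in> I \<Longrightarrow> 0 \<le> p i" and s: "0 \<le> s" "s \<le> 1"
  shows "s^3 * heavy_prob I p w \<le> heavy_prob (mix_I I) (mix_p s p) (case_option c w)"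
proof -
  let ?f = "\<lambda>x y z. mix_p s p x * mix_p s p y * mix_p s p z
     * of_bool (heavy (case_option c w x) (case_option c w y) (case_option c w z))"
  have nn: "0 \<le> ?f x y z" if "x \<in> mix_I I" "y \<in> mix_I I" "z \<in> mix_I I" for x y z
    using that p s by (auto simp: mix_p_def)
  have "s^3 * heavy_prob I p w = (\<Sum>x\<in>Some ` I. \<Sum>y\<in>Some ` I. \<Sum>z\<in>Some ` I. ?f x y z)"
    by (simp add: heavy_prob_def mix_p_def sum.reindex sum_distrib_left power3_eq_cube mult_ac)
  also have "\<dots> \<le> (\<Sum>x\<in>Some ` I. \<Sum>y\<in>Some ` I. \<Sum>z\<in>mix_I I. ?f x y z)"
    using I by (intro sum_mono sum_mono2 nn) auto
  also have "\<dots> \<le> (\<Sum>x\<in>Some ` I. \<Sum>y\<in>mix_I I. \<Sum>z\<in>mix_I I. ?f x y z)"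
    using I by (intro sum_mono sum_mono2 nn sum_nonneg) auto
  also have "\<dots> \<le> (\<Sum>x\<in>mix_I I. \<Sum>y\<in>mix_I I. \<Sum>z\<in>mix_I I. ?f x y z)"
    using I by (intro sum_mono2 nn sum_nonneg) auto
  finally show ?thesis by (simp only: heavy_prob_def)
qed

text \<open>Every triple that contains an atom of value 1 is heavy, so the triples that are not
  heavy avoid the atom and carry the factor \<open>s^3\<close>.\<close>

lemma heavy_prob_mix_one:
  assumes I: "finite I" and p1: "sum p I = 1" and w: "\<And>i. i \<in> I \<Longrightarrow> 0 \<le> w i"
  shows "1 - heavy_prob (mix_I I) (mix_p s p) (case_option 1 w) = s^3 * (1 - heavy_prob I p w)"
proof -
  have "1 - heavy_prob (mix_I I) (mix_p s p) (case_option 1 w) =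
    (\<Sum>i\<in>I. \<Sum>j\<in>I. \<Sum>k\<in>I. (s * p i) * (s * p j) * (s * p k) * of_bool (\<not> heavy (w i) (w j) (w k)))"
    unfolding heavy_prob_complement[OF sum_mix_p[OF I p1]] sum_mix_I[OF I]
    using w by (simp add: mix_p_def heavy_if_one cong: sum.cong)
  then show ?thesis
    unfolding heavy_prob_complement[OF p1]
    by (simp add: sum_distrib_left power3_eq_cube mult_ac)
qed

lemma heavy_prob_bound:
  assumes I: "finite I" and p: "\<And>i. i \<in> I \<Longrightarrow> 0 \<le> p i" and p1: "sum p I = 1"
    and w: "\<And>i. i \<in> I \<Longrightarrow> 0 \<le> w i" and mean: "wmean I p w \<le> \<beta>" and \<beta>: "0 < \<beta>"
  shows "heavy_prob I p w \<le> max (64 * \<beta>^3) (1 - (1 - \<beta>)^3)"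
proof -
  define v where "v = (\<lambda>i. min (w i) 1)"
  have v: "0 \<le> v i" "v i \<le> 1" if "i \<in> I" for i using w[OF that] by (auto simp: v_def)
  have meanv: "wmean I p v \<le> \<beta>"
    using wmean_mono[of I p v w] p mean by (auto simp: v_def)
  have "heavy_prob I p w \<le> heavy_prob I p v"
    unfolding v_def using p w by (intro heavy_prob_mono heavy_cap) auto
  also have "\<dots> \<le> max (64 * \<beta>^3) (1 - (1 - \<beta>)^3)"
  proof -
    obtain b :: real where b: "21 * b^2 + b = 1" "0 < b" "b < 1" using critical_root_exists by blast
    have b3: "1 - (1 - b)^3 = 64 * b^3"
    proof -
      have "b * (21 * b^2 + b) = b" using b by simp
      then show ?thesis by (simp add: power2_eq_square power3_eq_cube algebra_simps)
    qed
    show ?thesis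
    proof (cases "b \<le> \<beta>")
      case True
      \<comment> \<open>Dilution with an atom at 0 lowers the mean from \<beta> to \<open>b\<close>.
        The clique bound scales by the same factor \<open>s^3\<close> as the probability.\<close>
      define s where "s = b / \<beta>"
      have s: "0 < s" "s \<le> 1" using True b \<beta> by (auto simp: s_def)
      have "s * wmean I p v \<le> s * \<beta>" using s meanv by (intro mult_left_mono) auto
      then have "s * wmean I p v \<le> b" using \<beta> by (simp add: s_def)
      then have "heavy_prob (mix_I I) (mix_p s p) (case_option 0 v) \<le> 1 - (1 - b)^3"
        using s b by (intro heavy_prob_critical_mix I p p1 v) auto
      moreover have "s^3 * heavy_prob I p v \<le> heavy_prob (mix_I I) (mix_p s p) (case_option 0 v)"
        using s by (intro heavy_prob_mix_ge I p) auto
      ultimately have "s^3 * heavy_prob I p v \<le> 64 * b^3" using b3 by simp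
      also have "\<dots> = s^3 * (64 * \<beta>^3)" using \<beta> by (simp add: s_def field_simps)
      finally show ?thesis using s by simp
    next
      case False
      \<comment> \<open>An atom at 1 raises the mean from \<beta> to \<open>b\<close>; the cube in
        the star bound and the probability of not being heavy both scale by
        \<open>s^3\<close>.\<close>
      define s where "s = (1 - b) / (1 - \<beta>)"
      have s: "0 < s" "s \<le> 1" using False b by (auto simp: s_def field_simps)
      have sb: "s * (1 - \<beta>) = 1 - b" using False b by (simp add: s_def)
      have "s * wmean I p v \<le> s * \<beta>" using s meanv by (intro mult_left_mono) auto
      then have mean': "(1 - s) * 1 + s * wmean I p v \<le> b" using sb by (simp add: algebra_simps)
      have "heavy_prob (mix_I I) (mix_p s p) (case_option 1 v) \<le> 1 - (1 - b)^3"
        using s b mean' by (intro heavy_prob_critical_mix I p p1 v) auto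
      moreover have "1 - heavy_prob (mix_I I) (mix_p s p) (case_option 1 v) = s^3 * (1 - heavy_prob I p v)"
        by (intro heavy_prob_mix_one I p1 v) auto
      ultimately have "(s * (1 - \<beta>))^3 \<le> s^3 * (1 - heavy_prob I p v)" using sb by simp
      then have "(1 - \<beta>)^3 \<le> 1 - heavy_prob I p v" using s by (simp add: power_mult_distrib)
      then show ?thesis by simp
    qed
  qed
  finally show ?thesis .
qed

section \<open>Tiles in dense patterns\<close>

text \<open>Potential argument: always choosing a vector that is light for the weights given by the current
  excess loads keeps the sum of the squared excess loads growing at most linearly.\<close>

lemma balanced_choice:
  fixes val :: "'t \<Rightarrow> 'q \<Rightarrow> real"
  assumes light: "\<And>w. (\<And>q. q \<in> P \<Longrightarrow> 0 \<le> w q) \<Longrightarrow> \<exists>x\<in>V. (\<Sum>q\<in>P. w q * val x q) \<le> c * (\<Sum>q\<in>P. w q)"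
    and R: "\<And>x q. x \<in> V \<Longrightarrow> q \<in> P \<Longrightarrow> \<bar>val x q - c\<bar> \<le> R"
  shows "\<exists>f. (\<forall>j<J. f j \<in> V) \<and>
    (\<Sum>q\<in>P. (max 0 ((\<Sum>j<J. val (f j) q) - c * real J))\<^sup>2) \<le> real J * (real (card P) * R\<^sup>2)"
proof (induction J)
  case 0
  then show ?case by simp
next
  case (Suc J)
  then obtain f where f: "\<forall>j<J. f j \<in> V" and
    pot: "(\<Sum>q\<in>P. (max 0 ((\<Sum>j<J. val (f j) q) - c * real J))\<^sup>2) \<le> real J * (real (card P) * R\<^sup>2)"
    by blast
  define y where "y q = (\<Sum>j<J. val (f j) q) - c * real J" for q
  obtain x where x: "x \<in> V" "(\<Sum>q\<in>P. max 0 (y q) * val x q) \<le> c * (\<Sum>q\<in>P. max 0 (y q))"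
    using light[of "\<lambda>q. max 0 (y q)"] by auto
  define g where "g = f(J := x)"
  have load: "(\<Sum>j<Suc J. val (g j) q) - c * real (Suc J) = y q + (val x q - c)" for q
  proof -
    have "(\<Sum>j<J. val (g j) q) = (\<Sum>j<J. val (f j) q)"
      by (intro sum.cong) (auto simp: g_def)
    then show ?thesis by (simp add: g_def y_def algebra_simps)
  qed
  have step: "(max 0 (y q + (val x q - c)))\<^sup>2 \<le> (max 0 (y q))\<^sup>2 + 2 * (max 0 (y q) * val x q - c * max 0 (y q)) + R\<^sup>2"
    if "q \<in> P" for q
  proof -
    have "(max 0 (y q + (val x q - c)))\<^sup>2 \<le> (max 0 (y q) + (val x q - c))\<^sup>2"
    proof (cases "0 \<le> y q + (val x q - c)")
      case True
      then show ?thesis by (intro power_mono) auto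
    qed simp
    moreover have "(val x q - c)\<^sup>2 \<le> R\<^sup>2"
      using R[OF x(1) that] by (metis abs_le_square_iff abs_ge_self abs_of_nonneg abs_ge_zero order_trans)
    ultimately show ?thesis by (simp add: power2_eq_square algebra_simps)
  qed
  have "(\<Sum>q\<in>P. (max 0 ((\<Sum>j<Suc J. val (g j) q) - c * real (Suc J)))\<^sup>2)
    \<le> (\<Sum>q\<in>P. (max 0 (y q))\<^sup>2 + 2 * (max 0 (y q) * val x q - c * max 0 (y q)) + R\<^sup>2)"
    unfolding load by (intro sum_mono step)
  also have "\<dots> = (\<Sum>q\<in>P. (max 0 (y q))\<^sup>2)
      + 2 * ((\<Sum>q\<in>P. max 0 (y q) * val x q) - c * (\<Sum>q\<in>P. max 0 (y q))) + real (card P) * R\<^sup>2"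
    by (simp add: sum.distrib sum_subtractf sum_distrib_left[symmetric])
  also have "\<dots> \<le> real J * (real (card P) * R\<^sup>2) + 0 + real (card P) * R\<^sup>2"
    using pot x(2) by (intro add_mono) (auto simp: y_def)
  also have "\<dots> = real (Suc J) * (real (card P) * R\<^sup>2)" by (simp add: algebra_simps)
  finally have "(\<Sum>q\<in>P. (max 0 ((\<Sum>j<Suc J. val (g j) q) - c * real (Suc J)))\<^sup>2)
    \<le> real (Suc J) * (real (card P) * R\<^sup>2)" .
  moreover have "\<forall>j<Suc J. g j \<in> V" using f x by (auto simp: g_def)
  ultimately show ?case by blast
qed

text \<open>Each squared excess load is a single summand of the potential, so after \<open>J\<close>
  rounds every load exceeds \<open>c * J\<close> by at most order \<open>sqrt J\<close>.\<close>

lemma balanced_choice_load: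
  fixes val :: "'t \<Rightarrow> 'q \<Rightarrow> real"
  assumes "finite P"
    and light: "\<And>w. (\<And>q. q \<in> P \<Longrightarrow> 0 \<le> w q) \<Longrightarrow> \<exists>x\<in>V. (\<Sum>q\<in>P. w q * val x q) \<le> c * (\<Sum>q\<in>P. w q)"
    and R: "\<And>x q. x \<in> V \<Longrightarrow> q \<in> P \<Longrightarrow> \<bar>val x q - c\<bar> \<le> R" "0 \<le> R"
  shows "\<exists>f. (\<forall>j<J. f j \<in> V) \<and>
    (\<forall>q\<in>P. (\<Sum>j<J. val (f j) q) \<le> c * real J + sqrt (real J * real (card P)) * R)"
proof -
  obtain f where f: "\<forall>j<J. f j \<in> V" and
    pot: "(\<Sum>q\<in>P. (max 0 ((\<Sum>j<J. val (f j) q) - c * real J))\<^sup>2) \<le> real J * (real (card P) * R\<^sup>2)"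
    using balanced_choice[OF light R(1)] by blast
  have "(\<Sum>j<J. val (f j) q) \<le> c * real J + sqrt (real J * real (card P)) * R" if "q \<in> P" for q
  proof -
    let ?y = "(\<Sum>j<J. val (f j) q) - c * real J"
    have "(max 0 ?y)\<^sup>2 \<le> (\<Sum>q\<in>P. (max 0 ((\<Sum>j<J. val (f j) q) - c * real J))\<^sup>2)"
      using that \<open>finite P\<close> by (intro member_le_sum) auto
    with pot have "(max 0 ?y)\<^sup>2 \<le> real J * real (card P) * R\<^sup>2" by (simp add: mult.assoc)
    then have "max 0 ?y \<le> sqrt (real J * real (card P) * R\<^sup>2)" by (rule real_le_rsqrt)
    also have "\<dots> = sqrt (real J * real (card P)) * R"
      using R(2) by (simp add: real_sqrt_mult)
    finally show ?thesis by simp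
  qed
  with f show ?thesis by blast
qed

text \<open>A tile \<open>(a, b, c)\<close> of a pattern uses the edge \<open>{a, b, c}\<close> and two copies of the vertex \<open>a\<close>.\<close>

definition sorted_triples :: "nat \<Rightarrow> (nat \<times> nat \<times> nat) set" where
  "sorted_triples m = {(a, b, c). a < b \<and> b < c \<and> c < m}"

definition pattern_tiles :: "(nat \<times> nat \<times> nat) set \<Rightarrow> (nat \<times> nat \<times> nat) set" where
  "pattern_tiles K = {(a, b, c). (a, b, c) \<in> K \<or> (b, a, c) \<in> K \<or> (b, c, a) \<in> K}"

fun tile_mult :: "nat \<times> nat \<times> nat \<Rightarrow> nat \<Rightarrow> nat" where
  "tile_mult (a, b, c) q = 2 * of_bool (q = a) + of_bool (q = b) + of_bool (q = c)"

lemma pattern_tiles_distinct: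
  assumes "K \<subseteq> sorted_triples m" "(a, b, c) \<in> pattern_tiles K"
  shows "a < m" "b < m" "c < m" "a \<noteq> b" "a \<noteq> c" "b \<noteq> c"
  using assms by (auto simp: pattern_tiles_def sorted_triples_def)

section \<open>Light tiles by duality\<close>

definition perm3 :: "nat \<Rightarrow> nat \<times> nat \<times> nat \<Rightarrow> nat \<times> nat \<times> nat" where
  "perm3 r = (\<lambda>(a, b, c). if r = 0 then (a, b, c) else if r = 1 then (a, c, b) else if r = 2 then (b, a, c)
     else if r = 3 then (b, c, a) else if r = 4 then (c, a, b) else (c, b, a))"

text \<open>Heaviness is symmetric, and the six orders of distinct increasing triples are all
  different. This passes from edges to the ordered triples counted by
  \<open>heavy_prob\<close>.\<close>

lemma card_ordered_triples_ge:
  assumes K: "K \<subseteq> sorted_triples m"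
    and heavy: "\<And>a b c. (a, b, c) \<in> K \<Longrightarrow> heavy (w a) (w b) (w c)"
  shows "6 * card K \<le> card {(a, b, c). a < m \<and> b < m \<and> c < m \<and> heavy (w a) (w b) (w c)}" (is "_ \<le> card ?S")
proof -
  have inj: "inj_on (\<lambda>(x, r). perm3 r x) (K \<times> {..<6})"
  proof (rule inj_onI)
    fix x y assume xy: "x \<in> K \<times> {..<6}" "y \<in> K \<times> {..<6}"
      and eq: "(\<lambda>(x, r). perm3 r x) x = (\<lambda>(x, r). perm3 r x) y"
    obtain a b c r a' b' c' r' where x: "x = ((a, b, c), r)" and y: "y = ((a', b', c'), r')"
      by (metis prod.exhaust)
    have "r < 6" "r' < 6" "a < b" "b < c" "a' < b'" "b' < c'"
      using K xy x y by (auto simp: sorted_triples_def)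
    with eq show "x = y"
      by (auto simp: perm3_def x y split: if_splits)
  qed
  have sub: "(\<lambda>(x, r). perm3 r x) ` (K \<times> {..<6}) \<subseteq> ?S"
  proof (rule image_subsetI)
    fix u assume u: "u \<in> K \<times> {..<6::nat}"
    obtain a b c r where abc: "u = ((a, b, c), r)" by (metis prod.exhaust)
    obtain x y z where xyz: "perm3 r (a, b, c) = (x, y, z)" by (metis prod.exhaust)
    have "a < m" "b < m" "c < m" using K u abc by (auto simp: sorted_triples_def)
    moreover have "heavy (w a) (w b) (w c)" using heavy u abc by blast
    moreover have "heavy (w x) (w y) (w z) = heavy (w a) (w b) (w c)"
      using xyz by (auto simp: perm3_def heavy_def min_def split: if_splits)
    ultimately show "(\<lambda>(x, r). perm3 r x) u \<in> ?S"
      using xyz by (auto simp: abc perm3_def split: if_splits)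
  qed
  have "?S \<subseteq> {..<m} \<times> {..<m} \<times> {..<m}" by auto
  then have "finite ?S" by (rule finite_subset) auto
  from card_mono[OF this sub] have "card ((\<lambda>(x, r). perm3 r x) ` (K \<times> {..<6})) \<le> card ?S" .
  then show ?thesis by (simp add: card_image[OF inj] card_cartesian_product mult.commute)
qed

lemma heavy_prob_uniform:
  "heavy_prob {..<m} (\<lambda>_. 1 / real m) w
    = real (card {(a, b, c). a < m \<and> b < m \<and> c < m \<and> heavy (w a) (w b) (w c)}) / real m ^ 3"
proof -
  let ?H = "\<lambda>(a, b, c). heavy (w a) (w b) (w c)"
  let ?C = "{..<m} \<times> {..<m} \<times> {..<m}"
  have eq: "{(a, b, c). a < m \<and> b < m \<and> c < m \<and> heavy (w a) (w b) (w c)} = ?C \<inter> {x. ?H x}"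
    by auto
  have "heavy_prob {..<m} (\<lambda>_. 1 / real m) w
    = (\<Sum>i<m. \<Sum>j<m. \<Sum>k<m. of_bool (heavy (w i) (w j) (w k))) / real m ^ 3"
    by (simp add: heavy_prob_def sum_divide_distrib power3_eq_cube del: sum_of_bool_eq)
  also have "(\<Sum>i<m. \<Sum>j<m. \<Sum>k<m. of_bool (heavy (w i) (w j) (w k)))
     = (\<Sum>x\<in>?C. of_bool (?H x) :: real)"
    by (simp only: sum.cartesian_product split_def)
  also have "\<dots> = real (card (?C \<inter> {x. ?H x}))"
    by (simp add: sum_of_bool_eq)
  finally show ?thesis by (simp only: eq)
qed

text \<open>If all tiles were heavier than claimed, a rescaling of \<open>w\<close> to mean \<beta>
  would make every edge of \<open>K\<close> heavy, so \<open>K\<close> would have more heavy triples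
  than \<open>heavy_prob_bound\<close> permits. This is the dual form of a fractional
  tiling.\<close>

lemma light_pattern_tile:
  fixes \<beta> :: real
  assumes K: "K \<subseteq> sorted_triples m"
    and many: "real m ^ 3 * max (64 * \<beta>^3) (1 - (1 - \<beta>)^3) < 6 * real (card K)"
    and \<beta>: "0 < \<beta>" and w: "\<And>q. q \<in> {..<m} \<Longrightarrow> 0 \<le> w q"
  shows "\<exists>x\<in>pattern_tiles K. (\<Sum>q<m. w q * real (tile_mult x q)) \<le> 1 / (\<beta> * real m) * (\<Sum>q<m. w q)"
proof -
  have ne: "K \<noteq> {}"
  proof
    assume "K = {}"
    then have "real m ^ 3 * max (64 * \<beta>^3) (1 - (1 - \<beta>)^3) < 0" using many by simp
    moreover have "0 \<le> real m ^ 3 * max (64 * \<beta>^3) (1 - (1 - \<beta>)^3)"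
      using \<beta> by (intro mult_nonneg_nonneg) (auto simp: le_max_iff_disj)
    ultimately show False by linarith
  qed
  then have m: "0 < m" using K by (auto simp: sorted_triples_def)
  have val: "(\<Sum>q<m. w q * real (tile_mult (a, b, c) q)) = 2 * w a + w b + w c"
    if "(a, b, c) \<in> pattern_tiles K" for a b c
  proof -
    have "(\<Sum>q<m. w q * real (tile_mult (a, b, c) q)) = (\<Sum>q<m. (if q = a then 2 * w q else 0)
       + (if q = b then w q else 0) + (if q = c then w q else 0))"
      by (intro sum.cong) (auto simp: algebra_simps)
    also have "\<dots> = 2 * w a + w b + w c"
      using pattern_tiles_distinct[OF K that] by (simp add: sum.distrib)
    finally show ?thesis .
  qed
  show ?thesis
  proof (cases "(\<Sum>q<m. w q) = 0")
    case True
    then have "w q = 0" if "q < m" for q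
      using that w by (subst (asm) sum_nonneg_eq_0_iff) auto
    moreover obtain a b c where abc: "(a, b, c) \<in> K" using ne by auto
    then have "(a, b, c) \<in> pattern_tiles K" by (simp add: pattern_tiles_def)
    ultimately show ?thesis using True by (intro bexI[of _ "(a, b, c)"]) auto
  next
    case False
    then have S: "0 < (\<Sum>q<m. w q)" using sum_nonneg[of "{..<m}" w] w by force
    \<comment> \<open>This factor gives \<open>w\<close> the mean \<beta> and turns the threshold of
      the claim into 1. The sum of \<open>w\<close> is positive here, which is why zero weights are
      treated apart.\<close>
    define s where "s = \<beta> * real m / (\<Sum>q<m. w q)"
    have s: "0 < s" using S \<beta> m by (simp add: s_def)
    show ?thesis
    proof (rule ccontr)
      assume contra: "\<not> ?thesis"
      have big: "1 < s * (2 * w a + w b + w c)" if "(a, b, c) \<in> pattern_tiles K" for a b c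
      proof -
        have "1 / (\<beta> * real m) * (\<Sum>q<m. w q) < 2 * w a + w b + w c"
          using contra val that by force
        then show ?thesis using S \<beta> m by (simp add: s_def field_simps)
      qed
      have heavy: "heavy (s * w a) (s * w b) (s * w c)" if "(a, b, c) \<in> K" for a b c
      proof -
        have "1 < s * (2 * w a + w b + w c)" "1 < s * (2 * w b + w a + w c)" "1 < s * (2 * w c + w a + w b)"
          using that by (auto intro!: big simp: pattern_tiles_def)
        then show ?thesis by (auto simp: heavy_def min_def algebra_simps)
      qed
      have "heavy_prob {..<m} (\<lambda>_. 1 / real m) (\<lambda>q. s * w q) \<le> max (64 * \<beta>^3) (1 - (1 - \<beta>)^3)"
      proof (rule heavy_prob_bound)
        show "wmean {..<m} (\<lambda>_. 1 / real m) (\<lambda>q. s * w q) \<le> \<beta>"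
          using S m by (simp add: wmean_def sum_distrib_left[symmetric] sum_divide_distrib[symmetric] s_def)
      qed (use w s m \<beta> in auto)
      then have "real (card {(a, b, c). a < m \<and> b < m \<and> c < m \<and> heavy (s * w a) (s * w b) (s * w c)})
          \<le> real m ^ 3 * max (64 * \<beta>^3) (1 - (1 - \<beta>)^3)"
        using m unfolding heavy_prob_uniform by (simp add: pos_divide_le_eq mult.commute)
      moreover have "6 * card K \<le> card {(a, b, c). a < m \<and> b < m \<and> c < m \<and> heavy (s * w a) (s * w b) (s * w c)}"
        using card_ordered_triples_ge[OF K, of "\<lambda>q. s * w q"] heavy by simp
      ultimately show False using many by simp
    qed
  qed
qed

text \<open>An integral substitute for the fractional tiling: light tiles are chosen one after
  another by \<open>balanced_choice_load\<close> with \<open>c = 1 / (\<beta> * m)\<close>. The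
  deviation \<open>R = 2\<close> works because multiplicities and \<open>c\<close> lie between 0 and
  2.\<close>

lemma pattern_tile_sequence:
  fixes \<beta> :: real
  assumes K: "K \<subseteq> sorted_triples m"
    and many: "real m ^ 3 * max (64 * \<beta>^3) (1 - (1 - \<beta>)^3) < 6 * real (card K)"
    and \<beta>: "1 \<le> \<beta> * real m"
    and t: "real J / (\<beta> * real m) + 2 * sqrt (real J * real m) \<le> real t"
  shows "\<exists>f. (\<forall>j<J. f j \<in> pattern_tiles K) \<and> (\<forall>q<m. (\<Sum>j<J. tile_mult (f j) q) \<le> t)"
proof -
  have \<beta>0: "0 < \<beta>" using \<beta> by (metis less_le_trans mult_nonpos_nonneg not_le of_nat_0_le_iff zero_less_one)
  have "\<exists>f. (\<forall>j<J. f j \<in> pattern_tiles K) \<and> (\<forall>q\<in>{..<m}. (\<Sum>j<J. real (tile_mult (f j) q))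
      \<le> 1 / (\<beta> * real m) * real J + sqrt (real J * real (card {..<m})) * 2)"
  proof (rule balanced_choice_load)
    show "\<bar>real (tile_mult x q) - 1 / (\<beta> * real m)\<bar> \<le> 2" if x: "x \<in> pattern_tiles K" "q \<in> {..<m}" for x q
    proof -
      obtain a b c where abc: "x = (a, b, c)" by (cases x)
      then have "tile_mult x q \<le> 2" using pattern_tiles_distinct[OF K, of a b c] x by auto
      moreover have "0 \<le> 1 / (\<beta> * real m)" "1 / (\<beta> * real m) \<le> 1" using \<beta> by auto
      ultimately show ?thesis by linarith
    qed
  qed (use light_pattern_tile[OF K many \<beta>0] in auto)
  then obtain f where f: "\<forall>j<J. f j \<in> pattern_tiles K"
    "\<And>q. q < m \<Longrightarrow> (\<Sum>j<J. real (tile_mult (f j) q)) \<le> real J / (\<beta> * real m) + 2 * sqrt (real J * real m)"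
    by (auto simp: mult.commute)
  have "(\<Sum>j<J. tile_mult (f j) q) \<le> t" if "q < m" for q
  proof -
    have "real (\<Sum>j<J. tile_mult (f j) q) \<le> real t"
      using f(2)[OF that] t by simp
    then show ?thesis by (simp only: of_nat_le_iff)
  qed
  with f show ?thesis by blast
qed

section \<open>Boxes in dense subsets of grids\<close>

abbreviation grid :: "nat \<Rightarrow> nat \<Rightarrow> (nat \<Rightarrow> nat) set" where
  "grid s L \<equiv> PiE {..<s} (\<lambda>_. {..<L})"

lemma finite_grid [simp]: "finite (grid s L)"
  by (intro finite_PiE) auto

lemma card_grid [simp]: "card (grid s L) = L ^ s"
  by (simp add: card_PiE)

lemma card_grid_Suc:
  assumes "E \<subseteq> grid (Suc s) L"
  shows "card E = (\<Sum>y\<in>grid s L. card {a. a < L \<and> y(s := a) \<in> E})"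
proof -
  have "bij_betw (\<lambda>(y, a). y(s := a)) (SIGMA y:grid s L. {a. a < L \<and> y(s := a) \<in> E}) E"
  proof (rule bij_betw_byWitness[where f' = "\<lambda>x. (restrict x {..<s}, x s)"])
    show "\<forall>z\<in>(SIGMA y:grid s L. {a. a < L \<and> y(s := a) \<in> E}).
      (restrict ((\<lambda>(y, a). y(s := a)) z) {..<s}, (\<lambda>(y, a). y(s := a)) z s) = z"
      by (auto simp: restrict_def PiE_def extensional_def fun_eq_iff)
    have rejoin: "(restrict x {..<s})(s := x s) = x" if "x \<in> E" for x
    proof -
      have "x \<in> extensional {..<Suc s}" using that assms by (auto simp: PiE_def)
      then show ?thesis by (auto simp: restrict_def extensional_def fun_eq_iff less_Suc_eq)
    qed
    then show "\<forall>x\<in>E. (\<lambda>(y, a). y(s := a)) (restrict x {..<s}, x s) = x" by simp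
    show "(\<lambda>(y, a). y(s := a)) ` (SIGMA y:grid s L. {a. a < L \<and> y(s := a) \<in> E}) \<subseteq> E" by auto
    show "(\<lambda>x. (restrict x {..<s}, x s)) ` E \<subseteq> (SIGMA y:grid s L. {a. a < L \<and> y(s := a) \<in> E})"
    proof (rule image_subsetI)
      fix x assume x: "x \<in> E"
      then have "x \<in> grid (Suc s) L" using assms by auto
      then show "(restrict x {..<s}, x s) \<in> (SIGMA y:grid s L. {a. a < L \<and> y(s := a) \<in> E})"
        using x rejoin[OF x] by (auto simp: PiE_iff)
    qed
  qed
  then have "card E = card (SIGMA y:grid s L. {a. a < L \<and> y(s := a) \<in> E})"
    by (simp add: bij_betw_same_card)
  then show ?thesis by (simp add: card_SigmaI)
qed

text \<open>Double counting on the last coordinate. At least an \<open>\<epsilon> / 2\<close>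
  fraction of the points \<open>y\<close> have \<open>\<epsilon> * L / 2\<close> or more extensions
  into \<open>E\<close>, and each such point sees at least
  \<open>(\<epsilon> / (2 * t))^t * L^t\<close> sets of \<open>t\<close> extensions. As there are at
  most \<open>L^t\<close> sets of size \<open>t\<close>, one of them is seen by many points.\<close>

lemma dense_grid_has_box_step:
  fixes \<epsilon> :: real
  assumes \<epsilon>: "0 < \<epsilon>" and L: "t \<le> L" "0 < L" "2 * real t / \<epsilon> \<le> real L"
    and E: "E \<subseteq> grid (Suc s) L" "\<epsilon> * real L ^ Suc s \<le> real (card E)"
  shows "\<exists>A \<subseteq> {..<L}. card A = t \<and>
    (\<epsilon> / 2) * (\<epsilon> / (2 * real t)) ^ t * real L ^ s \<le> real (card {y \<in> grid s L. \<forall>a\<in>A. y(s := a) \<in> E})"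
proof -
  define N where "N y = {a. a < L \<and> y(s := a) \<in> E}" for y
  define G where "G = {y \<in> grid s L. \<epsilon> * real L / 2 \<le> real (card (N y))}"
  define \<A> where "\<A> = {A. A \<subseteq> {..<L} \<and> card A = t}"
  define c where "c = (\<epsilon> / 2) * (\<epsilon> / (2 * real t)) ^ t * real L ^ s"
  have finN: "finite (N y)" and cardN: "card (N y) \<le> L" for y
  proof -
    have *: "N y \<subseteq> {..<L}" by (auto simp: N_def)
    then show "finite (N y)" by (rule finite_subset) simp
    show "card (N y) \<le> L" using card_mono[OF _ *] by simp
  qed
  have finG: "finite G" by (simp add: G_def)
  have finA: "finite \<A>" unfolding \<A>_def by simp
  have cardA: "card \<A> = L choose t" using n_subsets[of "{..<L}" t] by (simp add: \<A>_def)
  have "real (card E) = (\<Sum>y\<in>grid s L. real (card (N y)))"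
    using card_grid_Suc[OF E(1)] by (simp add: N_def)
  also have "\<dots> \<le> (\<Sum>y\<in>grid s L. \<epsilon> * real L / 2 + real L * of_bool (y \<in> G))"
    using cardN \<epsilon> by (intro sum_mono) (auto simp: G_def add_increasing not_le less_imp_le)
  also have "\<dots> = real L ^ s * (\<epsilon> * real L / 2) + real L * real (card G)"
  proof -
    have "grid s L \<inter> {y. y \<in> G} = G" by (auto simp: G_def)
    then show ?thesis by (simp add: sum.distrib sum_distrib_left[symmetric])
  qed
  finally have "\<epsilon> * real L ^ Suc s \<le> real L ^ s * (\<epsilon> * real L / 2) + real L * real (card G)"
    using E(2) by simp
  then have "real L * (\<epsilon> / 2 * real L ^ s) \<le> real L * real (card G)" by (simp add: algebra_simps)
  then have cardG: "\<epsilon> / 2 * real L ^ s \<le> real (card G)" using L by simp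
  have many: "(\<epsilon> / (2 * real t)) ^ t * real L ^ t \<le> real (card (N y) choose t)" if "y \<in> G" for y
  proof -
    have y: "\<epsilon> * real L / 2 \<le> real (card (N y))" using that by (simp add: G_def)
    have "real t \<le> \<epsilon> * real L / 2" using L(3) \<epsilon> by (simp add: field_simps)
    with y have le: "t \<le> card (N y)" by linarith
    have "(\<epsilon> / (2 * real t)) ^ t * real L ^ t = (\<epsilon> * real L / 2 / real t) ^ t"
      by (simp add: power_mult_distrib[symmetric])
    also have "\<dots> \<le> (real (card (N y)) / real t) ^ t"
      using y \<epsilon> by (intro power_mono divide_right_mono) auto
    also have "\<dots> \<le> real (card (N y) choose t)" by (rule binomial_ge_n_over_k_pow_k[OF le])
    finally show ?thesis .
  qed
  have swap: "(\<Sum>A\<in>\<A>. card {y \<in> grid s L. A \<subseteq> N y}) = (\<Sum>y\<in>grid s L. card (N y) choose t)"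
  proof -
    have "(\<Sum>A\<in>\<A>. card {y \<in> grid s L. A \<subseteq> N y}) = (\<Sum>A\<in>\<A>. \<Sum>y\<in>grid s L. of_bool (A \<subseteq> N y))"
      by (simp add: Int_def)
    also have "\<dots> = (\<Sum>y\<in>grid s L. \<Sum>A\<in>\<A>. of_bool (A \<subseteq> N y))" by (rule sum.swap)
    also have "\<dots> = (\<Sum>y\<in>grid s L. card (N y) choose t)"
    proof (rule sum.cong)
      fix y assume "y \<in> grid s L"
      have "\<A> \<inter> {A. A \<subseteq> N y} = {A. A \<subseteq> N y \<and> card A = t}"
        by (auto simp: \<A>_def N_def)
      then show "(\<Sum>A\<in>\<A>. of_bool (A \<subseteq> N y)) = card (N y) choose t"
        using finA by (simp add: n_subsets[OF finN])
    qed simp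
    finally show ?thesis .
  qed
  have "c * real L ^ t \<le> real (card G) * ((\<epsilon> / (2 * real t)) ^ t * real L ^ t)"
    using mult_right_mono[OF cardG, of "(\<epsilon> / (2 * real t)) ^ t * real L ^ t"] \<epsilon>
    by (simp add: c_def mult_ac)
  also have "\<dots> \<le> (\<Sum>y\<in>G. real (card (N y) choose t))"
    using sum_bounded_below[of G "(\<epsilon> / (2 * real t)) ^ t * real L ^ t" "\<lambda>y. real (card (N y) choose t)"] many
    by simp
  also have "\<dots> \<le> (\<Sum>y\<in>grid s L. real (card (N y) choose t))"
    by (intro sum_mono2) (auto simp: G_def)
  also have "\<dots> = (\<Sum>A\<in>\<A>. real (card {y \<in> grid s L. A \<subseteq> N y}))"
    using swap by (metis (mono_tags, lifting) of_nat_sum sum.cong)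
  finally have main: "c * real L ^ t \<le> (\<Sum>A\<in>\<A>. real (card {y \<in> grid s L. A \<subseteq> N y}))" .
  have "\<exists>A\<in>\<A>. c \<le> real (card {y \<in> grid s L. A \<subseteq> N y})"
  proof (rule ccontr)
    assume "\<not> ?thesis"
    then have less: "\<And>A. A \<in> \<A> \<Longrightarrow> real (card {y \<in> grid s L. A \<subseteq> N y}) < c" by force
    have ne: "\<A> \<noteq> {}" using cardA finA L(1) by (metis binomial_eq_0_iff card.empty not_less)
    have "(\<Sum>A\<in>\<A>. real (card {y \<in> grid s L. A \<subseteq> N y})) < (\<Sum>A\<in>\<A>. c)"
      using finA ne less by (intro sum_strict_mono) auto
    also have "\<dots> = real (L choose t) * c" using cardA by simp
    also have "\<dots> \<le> real (L ^ t) * c"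
      using binomial_le_pow[OF L(1)] \<epsilon> by (intro mult_right_mono) (auto simp: c_def)
    finally show False using main by (simp add: mult.commute)
  qed
  then obtain A where A: "A \<in> \<A>" "c \<le> real (card {y \<in> grid s L. A \<subseteq> N y})" by blast
  have "{y \<in> grid s L. A \<subseteq> N y} = {y \<in> grid s L. \<forall>a\<in>A. y(s := a) \<in> E}"
    using A(1) by (auto simp: N_def \<A>_def)
  with A show ?thesis by (auto simp: c_def \<A>_def)
qed

text \<open>Erdos's theorem on complete \<open>s\<close>-partite subhypergraphs. A common set of
  \<open>t\<close> last coordinates is fixed first; the points that extend by all of them are still
  dense, with a density depending on \<epsilon> and \<open>t\<close> only, and the induction
  hypothesis applies to them.\<close>

lemma dense_grid_has_box:
  fixes \<epsilon> :: real
  assumes "0 < \<epsilon>"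
  shows "\<exists>L0. \<forall>L\<ge>L0. \<forall>E \<subseteq> grid s L. \<epsilon> * real L ^ s \<le> real (card E) \<longrightarrow>
    (\<exists>A. (\<forall>i<s. A i \<subseteq> {..<L} \<and> card (A i) = t) \<and> PiE {..<s} A \<subseteq> E)"
  using assms
proof (induction s arbitrary: \<epsilon>)
  case 0
  have "PiE {..<0} A \<subseteq> E" if E: "E \<subseteq> grid 0 L" "\<epsilon> * real L ^ 0 \<le> real (card E)"
    for E :: "(nat \<Rightarrow> nat) set" and L and A :: "nat \<Rightarrow> nat set"
  proof -
    have "E \<noteq> {}" using E(2) 0 by auto
    with E(1) show ?thesis by (simp add: subset_singleton_iff)
  qed
  then show ?case by blast
next
  case (Suc s)
  let ?\<epsilon> = "(\<epsilon> / 2) * (\<epsilon> / (2 * real t)) ^ t"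
  have "0 < ?\<epsilon>" using Suc.prems by (cases "t = 0") auto
  then obtain L0 where L0: "\<forall>L\<ge>L0. \<forall>E \<subseteq> grid s L. ?\<epsilon> * real L ^ s \<le> real (card E) \<longrightarrow>
    (\<exists>A. (\<forall>i<s. A i \<subseteq> {..<L} \<and> card (A i) = t) \<and> PiE {..<s} A \<subseteq> E)"
    by (rule exE[OF Suc.IH])
  let ?L0 = "L0 + t + 1 + nat \<lceil>2 * real t / \<epsilon>\<rceil>"
  have "\<exists>A. (\<forall>i<Suc s. A i \<subseteq> {..<L} \<and> card (A i) = t) \<and> PiE {..<Suc s} A \<subseteq> E"
    if L: "?L0 \<le> L" and E: "E \<subseteq> grid (Suc s) L" "\<epsilon> * real L ^ Suc s \<le> real (card E)" for L E
  proof -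
    have "2 * real t / \<epsilon> \<le> real L" "t \<le> L" "0 < L" using L by linarith+
    note step = dense_grid_has_box_step[OF Suc.prems this(2,3,1) E]
    then obtain B where B: "B \<subseteq> {..<L}" "card B = t"
      "?\<epsilon> * real L ^ s \<le> real (card {y \<in> grid s L. \<forall>a\<in>B. y(s := a) \<in> E})"
      by (elim exE conjE) (rule that)
    obtain A where A: "\<forall>i<s. A i \<subseteq> {..<L} \<and> card (A i) = t"
      "PiE {..<s} A \<subseteq> {y \<in> grid s L. \<forall>a\<in>B. y(s := a) \<in> E}"
    proof -
      have "L0 \<le> L" "{y \<in> grid s L. \<forall>a\<in>B. y(s := a) \<in> E} \<subseteq> grid s L" using L by auto
      from L0[rule_format, OF this B(3)] show thesis by (elim exE conjE) (rule that)
    qed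
    have "PiE {..<Suc s} (A(s := B)) \<subseteq> E"
    proof
      fix x assume x: "x \<in> PiE {..<Suc s} (A(s := B))"
      have "restrict x {..<s} \<in> PiE {..<s} A"
      proof (rule PiE_I)
        show "restrict x {..<s} i \<in> A i" if "i \<in> {..<s}" for i
          using PiE_mem[OF x, of i] that by simp
      qed simp
      then have "restrict x {..<s} \<in> {y \<in> grid s L. \<forall>a\<in>B. y(s := a) \<in> E}" by (rule subsetD[OF A(2)])
      then have "\<forall>a\<in>B. (restrict x {..<s})(s := a) \<in> E" unfolding mem_Collect_eq by (rule conjunct2)
      moreover have "x s \<in> B" using PiE_mem[OF x, of s] by simp
      ultimately have "(restrict x {..<s})(s := x s) \<in> E" by (rule bspec)
      moreover have "(restrict x {..<s})(s := x s) = x"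
      proof
        fix i show "((restrict x {..<s})(s := x s)) i = x i"
          using PiE_arb[OF x, of i] by (cases i s rule: linorder_cases) auto
      qed
      ultimately show "x \<in> E" by (simp only:)
    qed
    moreover have "\<forall>i<Suc s. (A(s := B)) i \<subseteq> {..<L} \<and> card ((A(s := B)) i) = t"
      using A(1) B by (simp add: less_Suc_eq)
    ultimately show ?thesis by (intro exI[of _ "A(s := B)"] conjI)
  qed
  then have "\<forall>L\<ge>?L0. \<forall>E \<subseteq> grid (Suc s) L. \<epsilon> * real L ^ Suc s \<le> real (card E) \<longrightarrow>
    (\<exists>A. (\<forall>i<Suc s. A i \<subseteq> {..<L} \<and> card (A i) = t) \<and> PiE {..<Suc s} A \<subseteq> E)"
    by (intro allI impI) assumption
  then show ?case by (rule exI)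
qed

section \<open>Averaging over the grid\<close>

text \<open>As no value has more than \<open>card U\<close> elements, at least
  \<open>\<delta> / card U\<close> of the points have a value with more than \<open>a\<close>
  elements, and these values are among \<open>2 ^ card U\<close> sets. The added 1 in the
  denominator makes the estimate strict and covers an empty \<open>U\<close>.\<close>

lemma popular_value:
  fixes K :: "'x \<Rightarrow> 'u set" and a \<delta> :: real
  assumes X: "finite X" and U: "finite U" and K: "\<And>x. x \<in> X \<Longrightarrow> K x \<subseteq> U"
    and avg: "(a + \<delta>) * real (card X) \<le> (\<Sum>x\<in>X. real (card (K x)))" and a: "0 \<le> a" and \<delta>: "0 < \<delta>"
  shows "\<exists>K0\<subseteq>U. (X \<noteq> {} \<longrightarrow> a < real (card K0)) \<and>
    \<delta> / (real (card U + 1) * 2 ^ card U) * real (card X) \<le> real (card {x \<in> X. K x = K0})"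
proof (cases "X = {}")
  case True
  then show ?thesis by (intro exI[of _ "{}"]) simp
next
  case False
  let ?c = "\<delta> / (real (card U + 1) * 2 ^ card U)"
  show ?thesis
  proof (rule ccontr)
    assume "\<not> ?thesis"
    then have less: "real (card {x \<in> X. K x = K0}) < ?c * real (card X)"
      if "K0 \<subseteq> U" "a < real (card K0)" for K0
      using that by (meson not_le)
    define S where "S = {x \<in> X. a < real (card (K x))}"
    have cX: "0 < real (card X)" using X False by (simp add: card_gt_0_iff)
    have cU: "card (K x) \<le> card U" if "x \<in> X" for x using K[OF that] U by (rule card_mono[rotated])
    have "(\<Sum>x\<in>X. real (card (K x))) \<le> (\<Sum>x\<in>X. a + real (card U) * of_bool (x \<in> S))"
      using a cU by (intro sum_mono) (auto simp: S_def not_less add_increasing)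
    also have "\<dots> = a * real (card X) + real (card U) * real (card S)"
    proof -
      have "X \<inter> {x. x \<in> S} = S" by (auto simp: S_def)
      then show ?thesis using X by (simp add: sum.distrib sum_distrib_left[symmetric])
    qed
    finally have "\<delta> * real (card X) \<le> real (card U) * real (card S)" using avg by (simp add: algebra_simps)
    moreover have "real (card S) \<le> 2 ^ card U * (?c * real (card X))"
    proof -
      have "S \<subseteq> (\<Union>K0\<in>{K0. K0 \<subseteq> U \<and> a < real (card K0)}. {x \<in> X. K x = K0})"
        using K by (auto simp: S_def)
      then have "card S \<le> card (\<Union>K0\<in>{K0. K0 \<subseteq> U \<and> a < real (card K0)}. {x \<in> X. K x = K0})"
        using X U by (intro card_mono finite_UN_I) auto
      also have "\<dots> \<le> (\<Sum>K0\<in>{K0. K0 \<subseteq> U \<and> a < real (card K0)}. card {x \<in> X. K x = K0})"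
        using U by (intro card_UN_le) auto
      finally have "real (card S) \<le> (\<Sum>K0\<in>{K0. K0 \<subseteq> U \<and> a < real (card K0)}. real (card {x \<in> X. K x = K0}))"
        by (simp flip: of_nat_sum)
      also have "\<dots> \<le> (\<Sum>K0\<in>{K0. K0 \<subseteq> U \<and> a < real (card K0)}. ?c * real (card X))"
        using less by (intro sum_mono) (auto intro: less_imp_le)
      also have "\<dots> \<le> (\<Sum>K0\<in>Pow U. ?c * real (card X))"
        using U \<delta> by (intro sum_mono2) auto
      also have "\<dots> = 2 ^ card U * (?c * real (card X))" by (simp add: card_Pow U)
      finally show ?thesis .
    qed
    ultimately have "\<delta> * real (card X) \<le> real (card U) * (2 ^ card U * (?c * real (card X)))"
      by (meson mult_left_mono of_nat_0_le_iff order_trans)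
    also have "\<dots> = \<delta> * real (card X) * (real (card U) / real (card U + 1))"
      by simp
    also have "\<dots> < \<delta> * real (card X) * 1"
      using \<delta> cX by (intro mult_strict_left_mono) auto
    finally show False by simp
  qed
qed

text \<open>The other \<open>s - 3\<close> coordinates are free. This counts the choices of blocks
  in which a given crossing triple becomes an edge.\<close>

lemma card_grid_three_coordinates:
  assumes ijk: "i < j" "j < k" "k < s"
  shows "card {x \<in> grid s L. R (x i) (x j) (x k)}
    = card {(a, b, c). a < L \<and> b < L \<and> c < L \<and> R a b c} * L ^ (s - 3)"
proof -
  let ?T = "{(a, b, c). a < L \<and> b < L \<and> c < L \<and> R a b c}"
  define F where "F = (\<lambda>(a, b, c). PiE {..<s} (\<lambda>l. if l = i then {a} else if l = j then {b} else if l = k then {c} else {..<L}))"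
  have "?T \<subseteq> {..<L} \<times> {..<L} \<times> {..<L}" by auto
  then have finT: "finite ?T" by (rule finite_subset) auto
  have mem: "x \<in> F (a, b, c) \<longleftrightarrow> x \<in> grid s L \<and> x i = a \<and> x j = b \<and> x k = c"
    if "a < L" "b < L" "c < L" for x a b c
  proof -
    let ?Q = "\<lambda>l. if l = i then {a} else if l = j then {b} else if l = k then {c} else {..<L}"
    have Q: "?Q i = {a}" "?Q j = {b}" "?Q k = {c}" "?Q l \<subseteq> {..<L}" for l using ijk that by simp_all
    show ?thesis
    proof
      assume "x \<in> F (a, b, c)"
      then have x: "x \<in> PiE {..<s} ?Q" by (simp only: F_def prod.case)
      have "x i \<in> ?Q i" "x j \<in> ?Q j" "x k \<in> ?Q k" using ijk by (intro PiE_mem[OF x]; simp)+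
      moreover have "PiE {..<s} ?Q \<subseteq> grid s L" by (intro PiE_mono Q)
      ultimately show "x \<in> grid s L \<and> x i = a \<and> x j = b \<and> x k = c" using x Q(1-3) by auto
    next
      assume x: "x \<in> grid s L \<and> x i = a \<and> x j = b \<and> x k = c"
      have "x l \<in> ?Q l" if "l < s" for l using x that PiE_mem[of x "{..<s}" "\<lambda>_. {..<L}" l] by auto
      then have "x \<in> PiE {..<s} ?Q" using x by (intro PiE_I) (auto simp: PiE_def extensional_def)
      then show "x \<in> F (a, b, c)" by (simp only: F_def prod.case)
    qed
  qed
  have "{x \<in> grid s L. R (x i) (x j) (x k)} = (\<Union>u\<in>?T. F u)"
  proof (intro equalityI subsetI)
    fix x assume x: "x \<in> {x \<in> grid s L. R (x i) (x j) (x k)}"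
    then have "x i < L" "x j < L" "x k < L" using ijk by (auto simp: PiE_iff)
    then show "x \<in> (\<Union>u\<in>?T. F u)" using x mem[of "x i" "x j" "x k" x]
      by (intro UN_I[of "(x i, x j, x k)"]) auto
  next
    fix x assume "x \<in> (\<Union>u\<in>?T. F u)"
    then obtain a b c where "a < L" "b < L" "c < L" "R a b c" "x \<in> F (a, b, c)" by blast
    then show "x \<in> {x \<in> grid s L. R (x i) (x j) (x k)}" using mem[of a b c x] by simp
  qed
  moreover have "card (\<Union>u\<in>?T. F u) = (\<Sum>u\<in>?T. card (F u))"
  proof (rule card_UN_disjoint[OF finT])
    show "\<forall>u\<in>?T. finite (F u)" by (auto simp: F_def intro!: finite_PiE)
    show "\<forall>u\<in>?T. \<forall>v\<in>?T. u \<noteq> v \<longrightarrow> F u \<inter> F v = {}"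
    proof (intro ballI impI)
      fix u v assume uv: "u \<in> ?T" "v \<in> ?T" "u \<noteq> v"
      obtain a b c a' b' c' where "u = (a, b, c)" "v = (a', b', c')" by (metis prod.exhaust)
      with uv mem show "F u \<inter> F v = {}" by auto
    qed
  qed
  moreover have "card (F u) = L ^ (s - 3)" for u
  proof -
    obtain a b c where u: "u = (a, b, c)" by (cases u)
    have "card (F u) = (\<Prod>l<s. if l \<in> {i, j, k} then 1 else L)"
      unfolding u F_def by (simp add: card_PiE) (intro prod.cong, auto)
    also have "\<dots> = L ^ card ({..<s} - {i, j, k})"
      by (simp only: prod.If_cases finite_lessThan Collect_mem_eq Diff_eq prod.neutral_const prod_constant mult_1)
    also have "card ({..<s} - {i, j, k}) = s - 3"
      using ijk by (subst card_Diff_subset) auto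
    finally show ?thesis .
  qed
  ultimately show ?thesis by simp
qed

section \<open>Tilings from blow-ups\<close>

lemma card_verts_Y32:
  assumes "is_Y32 G" shows "card (verts G) = 4" "finite (verts G)"
proof -
  obtain e f where ef: "edges G = {e, f}" "card (e \<inter> f) = 2" "verts G = e \<union> f" and G: "three_graph G"
    using assms by (auto simp: is_Y32_def)
  then have "card e = 3" "card f = 3" "finite e" "finite f"
    by (auto simp: three_graph_def)
  then show "card (verts G) = 4" "finite (verts G)" using ef card_Un_Int[of e f] by simp_all
qed

lemma Y32_tiling_props:
  assumes H: "three_graph H" and T: "Y32_tiling H T"
  shows "finite T" "covered T \<subseteq> verts H" "card (covered T) = 4 * card T"
proof -
  have "T \<subseteq> Pow (verts H) \<times> Pow (Pow (verts H))"
    using H T by (force simp: Y32_tiling_def subhypergraph_def three_graph_def)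
  moreover have "finite (verts H)" using H by (simp add: three_graph_def)
  ultimately show fin: "finite T" by (meson finite_Pow_iff finite_SigmaI finite_subset)
  show "covered T \<subseteq> verts H"
    using T by (auto simp: covered_def Y32_tiling_def subhypergraph_def)
  have "card (covered T) = (\<Sum>G\<in>T. card (verts G))"
    unfolding covered_def using T fin
    by (intro card_UN_disjoint') (auto simp: Y32_tiling_def card_verts_Y32)
  also have "\<dots> = (\<Sum>G\<in>T. 4)"
    using T by (intro sum.cong) (auto simp: Y32_tiling_def card_verts_Y32)
  finally show "card (covered T) = 4 * card T" by simp
qed

definition Y32_copy :: "'a \<Rightarrow> 'a \<Rightarrow> 'a \<Rightarrow> 'a \<Rightarrow> 'a hypergraph" where
  "Y32_copy x x' y z = ({x, x', y, z}, {{x, y, z}, {x', y, z}})"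

lemma is_Y32_copy: "distinct [x, x', y, z] \<Longrightarrow> is_Y32 (Y32_copy x x' y z)"
proof -
  assume d: "distinct [x, x', y, z]"
  then have "{x, y, z} \<inter> {x', y, z} = {y, z}" by auto
  then have "card ({x, y, z} \<inter> {x', y, z}) = 2" using d by simp
  with d show ?thesis
    unfolding is_Y32_def three_graph_def Y32_copy_def by (intro conjI exI[of _ "{x, y, z}"] exI[of _ "{x', y, z}"]) auto
qed

text \<open>Given an embedded blow-up of a pattern, the \<open>j\<close>-th tile uses the copies of its vertices that
  have not been used by the earlier tiles.\<close>

lemma tiling_of_blowup:
  fixes \<phi> :: "nat \<Rightarrow> nat \<Rightarrow> 'a"
  assumes H: "three_graph H"
    and inj: "\<And>q l q' l'. \<lbrakk>q < m; l < t; q' < m; l' < t; \<phi> q l = \<phi> q' l'\<rbrakk> \<Longrightarrow> q = q' \<and> l = l'"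
    and K: "K \<subseteq> sorted_triples m"
    and edge: "\<And>a b c x y z. \<lbrakk>(a, b, c) \<in> K; x < t; y < t; z < t\<rbrakk> \<Longrightarrow> {\<phi> a x, \<phi> b y, \<phi> c z} \<in> edges H"
    and f: "\<And>j. j < J \<Longrightarrow> f j \<in> pattern_tiles K"
    and load: "\<And>q. q < m \<Longrightarrow> (\<Sum>j<J. tile_mult (f j) q) \<le> t"
  shows "\<exists>T. Y32_tiling H T \<and> card T = J \<and> covered T \<subseteq> {\<phi> q l |q l. q < m \<and> l < t}"
proof -
  define used where "used j q = (\<Sum>i<j. tile_mult (f i) q)" for j q
  define S where "S j = {(q, l). q < m \<and> used j q \<le> l \<and> l < used (Suc j) q}" for j
  define P where "P = (\<lambda>(q, l). \<phi> q l)"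
  have used_mono: "used i q \<le> used j q" if "i \<le> j" for i j q
    unfolding used_def using that by (intro sum_mono2) auto
  have S_sub: "S j \<subseteq> {..<m} \<times> {..<t}" if "j < J" for j
  proof -
    have "used (Suc j) q \<le> t" if "q < m" for q
      using used_mono[of "Suc j" J q] load[OF that] \<open>j < J\<close> by (simp add: used_def)
    then show ?thesis by (fastforce simp: S_def)
  qed
  have S_disj: "S i \<inter> S j = {}" if "i < j" for i j
  proof -
    have "used (Suc i) q \<le> used j q" for q using that by (intro used_mono) simp
    then show ?thesis by (auto simp: S_def) (meson leD order_trans)
  qed
  have P_disj: "P ` S i \<inter> P ` S j = {}" if "i < j" "j < J" for i j
  proof -
    have "inj_on P ({..<m} \<times> {..<t})" using inj by (auto simp: inj_on_def P_def)
    then show ?thesis using inj_on_image_Int[of P _ "S i" "S j"] S_sub[of i] S_sub[of j] S_disj[OF that(1)] that by simp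
  qed
  have "\<exists>Y. is_Y32 Y \<and> subhypergraph Y H \<and> verts Y = P ` S j" if j: "j < J" for j
  proof -
    obtain a b c where abc: "f j = (a, b, c)" by (cases "f j")
    have tile: "(a, b, c) \<in> pattern_tiles K" using f[OF j] abc by simp
    note d = pattern_tiles_distinct[OF K tile]
    define u where "u = used j"
    have Suc: "used (Suc j) q = u q + tile_mult (a, b, c) q" for q
      by (simp add: used_def u_def abc)
    have S: "S j = {(a, u a), (a, Suc (u a)), (b, u b), (c, u c)}"
    proof -
      have "(q, l) \<in> S j \<longleftrightarrow> (q, l) \<in> {(a, u a), (a, Suc (u a)), (b, u b), (c, u c)}" for q l
        using d by (cases "q = a"; cases "q = b"; cases "q = c") (auto simp: S_def Suc u_def[symmetric])
      then show ?thesis by (simp only: set_eq_iff split_paired_All) blast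
    qed
    have lt: "u a < t" "Suc (u a) < t" "u b < t" "u c < t"
      using S_sub[OF j] by (auto simp: S)
    let ?Y = "Y32_copy (\<phi> a (u a)) (\<phi> a (Suc (u a))) (\<phi> b (u b)) (\<phi> c (u c))"
    have "is_Y32 ?Y"
    proof (rule is_Y32_copy)
      have ne: "\<phi> q l \<noteq> \<phi> q' l'" if "q < m" "l < t" "q' < m" "l' < t" "q \<noteq> q' \<or> l \<noteq> l'" for q l q' l'
        using inj that by blast
      show "distinct [\<phi> a (u a), \<phi> a (Suc (u a)), \<phi> b (u b), \<phi> c (u c)]"
        using d lt by (simp add: ne)
    qed
    moreover have verts: "verts ?Y = P ` S j" by (simp add: Y32_copy_def S P_def)
    moreover have "subhypergraph ?Y H"
    proof -
      have e: "{\<phi> a x, \<phi> b (u b), \<phi> c (u c)} \<in> edges H" if "x < t" for x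
        using tile edge[OF _ that lt(3,4)] edge[OF _ lt(3) that lt(4)] edge[OF _ lt(3,4) that]
        by (auto simp: pattern_tiles_def insert_commute)
      have "edges ?Y \<subseteq> edges H" using e lt by (simp add: Y32_copy_def)
      moreover have "verts ?Y = \<Union> (edges ?Y)" by (auto simp: Y32_copy_def)
      ultimately show ?thesis using H by (auto simp: subhypergraph_def three_graph_def)
    qed
    ultimately show ?thesis by blast
  qed
  then obtain Y where Y: "\<And>j. j < J \<Longrightarrow> is_Y32 (Y j) \<and> subhypergraph (Y j) H \<and> verts (Y j) = P ` S j"
    by metis
  have disj: "verts (Y i) \<inter> verts (Y j) = {}" if "i < J" "j < J" "i \<noteq> j" for i j
    using P_disj[of i j] P_disj[of j i] Y that by (cases i j rule: linorder_cases) auto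
  have "inj_on Y {..<J}"
  proof (rule inj_onI, rule ccontr)
    fix i j assume ij: "i \<in> {..<J}" "j \<in> {..<J}" "Y i = Y j" "i \<noteq> j"
    then have "verts (Y i) = {}" using disj[of i j] by simp
    then show False using card_verts_Y32(1)[of "Y i"] Y ij by auto
  qed
  then have "card (Y ` {..<J}) = J" by (simp add: card_image)
  moreover have "Y32_tiling H (Y ` {..<J})"
    unfolding Y32_tiling_def
  proof
    show "\<forall>G\<in>Y ` {..<J}. is_Y32 G \<and> subhypergraph G H" using Y by auto
    show "disjoint_family_on verts (Y ` {..<J})"
      unfolding disjoint_family_on_def
    proof (intro ballI impI)
      fix G G' assume "G \<in> Y ` {..<J}" "G' \<in> Y ` {..<J}" "G \<noteq> G'"
      then obtain i j where "G = Y i" "G' = Y j" "i < J" "j < J" "i \<noteq> j" by blast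
      then show "verts G \<inter> verts G' = {}" using disj by simp
    qed
  qed
  moreover have "covered (Y ` {..<J}) \<subseteq> {\<phi> q l |q l. q < m \<and> l < t}"
    using Y S_sub by (fastforce simp: covered_def P_def)
  ultimately show ?thesis by blast
qed

text \<open>The vertices are numbered so that the tiles fill the first blocks of four positions and
  the uncovered vertices come last.\<close>

lemma tiling_enumeration:
  assumes H: "three_graph H" and T: "Y32_tiling H T"
  shows "\<exists>\<psi> g. bij_betw \<psi> {..<card (verts H)} (verts H) \<and> bij_betw g {..<card T} T \<and>
    4 * card T \<le> card (verts H) \<and> (\<forall>i<card T. verts (g i) = \<psi> ` {4 * i..<4 * i + 4})"
proof -
  let ?n = "card (verts H)" and ?k = "card T"
  note props = Y32_tiling_props[OF H T]
  have finV: "finite (verts H)" using H by (simp add: three_graph_def)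
  have le: "4 * ?k \<le> ?n" using card_mono[OF finV props(2)] props(3) by simp
  obtain g where g: "bij_betw g {..<?k} T"
    using ex_bij_betw_nat_finite[OF props(1)] by (auto simp: lessThan_atLeast0)
  have Yg: "is_Y32 (g i)" if "i < ?k" for i
    using g T that by (auto simp: bij_betw_def Y32_tiling_def)
  have "\<exists>h. bij_betw h {..<4::nat} (verts (g i))" if "i < ?k" for i
    using card_verts_Y32[OF Yg[OF that]] ex_bij_betw_nat_finite[of "verts (g i)"] by (auto simp: lessThan_atLeast0)
  then obtain h where h: "\<And>i. i < ?k \<Longrightarrow> bij_betw (h i) {..<4::nat} (verts (g i))" by metis
  define \<psi>0 where "\<psi>0 x = h (x div 4) (x mod 4)" for x
  have img: "\<psi>0 ` {4 * i..<4 * i + 4} = verts (g i)" if "i < ?k" for i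
  proof -
    have "{4 * i..<4 * i + 4} = (\<lambda>r. 4 * i + r) ` {..<4}"
      by (simp add: image_add_atLeastLessThan lessThan_atLeast0 add.commute)
    then have "\<psi>0 ` {4 * i..<4 * i + 4} = (\<lambda>r. \<psi>0 (4 * i + r)) ` {..<4}"
      by (simp only: image_image)
    also have "\<dots> = h i ` {..<4}" by (intro image_cong) (auto simp: \<psi>0_def)
    finally have "\<psi>0 ` {4 * i..<4 * i + 4} = h i ` {..<4}" .
    then show ?thesis using h[OF that] by (simp add: bij_betw_def)
  qed
  have "\<psi>0 ` {..<4 * ?k} = covered T"
  proof -
    have "{..<4 * ?k} = (\<Union>i<?k. {4 * i..<4 * i + 4})"
    proof (intro equalityI subsetI)
      fix x assume "x \<in> {..<4 * ?k}"
      then show "x \<in> (\<Union>i<?k. {4 * i..<4 * i + 4})" by (intro UN_I[of "x div 4"]) auto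
    qed auto
    then have "\<psi>0 ` {..<4 * ?k} = (\<Union>i<?k. verts (g i))" using img by (simp add: image_UN)
    also have "\<dots> = (\<Union>G\<in>g ` {..<?k}. verts G)" by simp
    also have "\<dots> = covered T" by (simp only: covered_def bij_betw_imp_surj_on[OF g])
    finally show ?thesis .
  qed
  \<comment> \<open>Injectivity is free: \<open>4 * card T\<close> positions are mapped onto a set
    of that size.\<close>
  then have bij0: "bij_betw \<psi>0 {..<4 * ?k} (covered T)"
    using props(3) by (intro bij_betw_imageI eq_card_imp_inj_on) auto
  have "finite (covered T)" using props(2) finV finite_subset by blast
  then have "card (verts H - covered T) = card {4 * ?k..<?n}"
    using props by (simp add: card_Diff_subset)
  then obtain \<psi>1 where bij1: "bij_betw \<psi>1 {4 * ?k..<?n} (verts H - covered T)"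
    using finite_same_card_bij[of "{4 * ?k..<?n}" "verts H - covered T"] finV by auto
  define \<psi> where "\<psi> x = (if x < 4 * ?k then \<psi>0 x else \<psi>1 x)" for x
  have "bij_betw \<psi> ({..<4 * ?k} \<union> {4 * ?k..<?n}) (covered T \<union> (verts H - covered T))"
  proof (rule bij_betw_combine)
    show "bij_betw \<psi> {..<4 * ?k} (covered T)"
      using bij0 by (rule bij_betw_cong[THEN iffD1, rotated]) (simp add: \<psi>_def)
    show "bij_betw \<psi> {4 * ?k..<?n} (verts H - covered T)"
      using bij1 by (rule bij_betw_cong[THEN iffD1, rotated]) (simp add: \<psi>_def)
  qed auto
  moreover have "{..<4 * ?k} \<union> {4 * ?k..<?n} = {..<?n}" using le by auto
  moreover have "covered T \<union> (verts H - covered T) = verts H" using props(2) by auto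
  ultimately have bij: "bij_betw \<psi> {..<?n} (verts H)" by (simp only:)
  have "verts (g i) = \<psi> ` {4 * i..<4 * i + 4}" if "i < ?k" for i
  proof -
    have "\<psi> ` {4 * i..<4 * i + 4} = \<psi>0 ` {4 * i..<4 * i + 4}"
      using that by (intro image_cong) (auto simp: \<psi>_def)
    then show ?thesis using img[OF that] by simp
  qed
  then show ?thesis using bij g le by (intro exI[of _ \<psi>] exI[of _ g] conjI allI impI)
qed

section \<open>Patterns of a hypergraph\<close>

text \<open>The positions \<open>0, 1, 2, \<dots>\<close> are grouped into blocks of four, and the blocks into intervals of
  \<open>L\<close> blocks. A pattern vertex \<open>q\<close> stands for the \<open>q mod 4\<close>-th position of a block to be chosen in the
  \<open>q div 4\<close>-th interval.\<close>

definition pos :: "nat \<Rightarrow> nat \<Rightarrow> nat \<Rightarrow> nat" where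
  "pos L q x = 4 * ((q div 4) * L + x) + q mod 4"

text \<open>The three intervals have to be distinct so that the three blocks are independent
  coordinates of a grid point.\<close>

definition crossing :: "nat \<Rightarrow> (nat \<times> nat \<times> nat) set" where
  "crossing s = {(a, b, c). a div 4 < b div 4 \<and> b div 4 < c div 4 \<and> c < 4 * s}"

lemma less_of_div_less: "a div k < b div k \<Longrightarrow> a < (b::nat)"
  by (metis div_le_mono not_less)

lemma crossing_sorted: "crossing s \<subseteq> sorted_triples (4 * s)"
  by (auto simp: crossing_def sorted_triples_def dest: less_of_div_less)

lemma finite_crossing: "finite (crossing s)"
proof (rule finite_subset)
  show "crossing s \<subseteq> {..<4 * s} \<times> {..<4 * s} \<times> {..<4 * s}"
    using crossing_sorted[of s] by (auto simp: sorted_triples_def)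
qed auto

lemma pos_div: "pos L q x div 4 = (q div 4) * L + x"
  by (simp add: pos_def)

lemma pos_less:
  assumes "q < 4 * s" "x < L" "4 * s * L \<le> n" shows "pos L q x < n"
proof -
  have "q div 4 < s" using assms(1) by (simp add: div_less_iff_less_mult mult.commute)
  then have "Suc (q div 4) * L \<le> s * L" by (intro mult_le_mono1) simp
  then have "(q div 4) * L + x + 1 \<le> s * L" using assms(2) by simp
  then have "4 * ((q div 4) * L + x) + 4 \<le> 4 * s * L" by simp
  then show ?thesis using assms(3) unfolding pos_def by (smt (verit) add_less_le_mono mod_less_divisor not_less zero_less_numeral le_trans nat_add_left_cancel_less less_le_trans)
qed

lemma pos_inj:
  assumes "x < L" "x' < L" "pos L q x = pos L q' x'" shows "q = q' \<and> x = x'"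
proof -
  have "(q div 4) * L + x = (q' div 4) * L + x'" using assms(3) pos_div by metis
  then have "((q div 4) * L + x) div L = ((q' div 4) * L + x') div L"
    "((q div 4) * L + x) mod L = ((q' div 4) * L + x') mod L" by simp_all
  then have "q div 4 = q' div 4" "x = x'" using assms(1,2) by simp_all
  moreover have "q mod 4 = q' mod 4"
  proof -
    have "pos L q x mod 4 = q mod 4" for q x by (simp only: pos_def mod_mult_self4 mod_mod_trivial)
    then show ?thesis using assms(3) by metis
  qed
  ultimately show ?thesis by (metis div_mult_mod_eq)
qed

text \<open>Mixed radix expansion: \<open>p\<close> splits into its interval, the block inside the
  interval and the place inside the block. The first and the last form \<open>q\<close>, the middle
  one is \<open>x\<close>.\<close>

lemma pos_surj:
  assumes "p < 4 * s * L"
  obtains q x where "q < 4 * s" "x < L" "pos L q x = p" "q div 4 = p div (4 * L)"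
proof
  have L: "0 < L" using assms by (cases L) auto
  let ?q = "4 * (p div (4 * L)) + p mod 4" and ?x = "(p mod (4 * L)) div 4"
  have "p div (4 * L) < s" using assms L by (simp add: div_less_iff_less_mult mult_ac)
  then show "?q < 4 * s" by linarith
  show "?x < L" using L by (simp add: div_less_iff_less_mult mult.commute)
  show "?q div 4 = p div (4 * L)" by simp
  have "4 * ?x + p mod 4 = p mod (4 * L)"
  proof -
    have "p mod (4 * L) mod 4 = p mod 4" by (simp add: mod_mod_cancel)
    then show ?thesis by (metis mult_div_mod_eq)
  qed
  moreover have "?q mod 4 = p mod 4" "?q div 4 = p div (4 * L)" by simp_all
  ultimately have "pos L ?q ?x = 4 * L * (p div (4 * L)) + p mod (4 * L)"
    unfolding pos_def by (simp only: distrib_left mult_ac add.assoc)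
  then show "pos L ?q ?x = p" by simp
qed

section \<open>Splitting the edges by intervals\<close>

lemma card_3_sorted:
  fixes A :: "'b::linorder set"
  assumes "card A = 3" shows "\<exists>x y z. A = {x, y, z} \<and> x < y \<and> y < z"
proof -
  have *: "\<exists>x y z. {p, q, r} = {x, y, z} \<and> x < y \<and> y < z" if d: "p \<noteq> q" "p \<noteq> r" "q \<noteq> r" "p < q" for p q r :: 'b
  proof -
    consider "r < p" | "p < r" "r < q" | "q < r" using d by (meson linorder_neqE)
    then show ?thesis
      by cases (use d in \<open>metis insert_commute\<close>)+
  qed
  obtain p q r where "A = {p, q, r}" "p \<noteq> q" "q \<noteq> r" "p \<noteq> r" using assms by (auto simp: card_3_iff)
  then show ?thesis using *[of p q r] *[of q p r] by (metis insert_commute linorder_neqE)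
qed

text \<open>An edge either has its vertices in three different intervals (\<open>A\<close>), or has
  a vertex among the leftover positions from \<open>4 * s * L\<close> on (\<open>B1\<close>), or has
  two vertices in one interval (\<open>B2\<close>).\<close>

lemma card_edges_le_crossing:
  assumes H: "three_graph H" and \<psi>: "bij_betw \<psi> {..<n} (verts H)" and L: "0 < L" "4 * s * L \<le> n"
  shows "card (edges H) \<le> (\<Sum>u\<in>crossing s. card ((\<lambda>(a, b, c). {(x, y, z). x < L \<and> y < L \<and> z < L \<and>
      {\<psi> (pos L a x), \<psi> (pos L b y), \<psi> (pos L c z)} \<in> edges H}) u))
    + (n - 4 * s * L) * n\<^sup>2 + 4 * L * n\<^sup>2"
    (is "_ \<le> (\<Sum>u\<in>_. card (?R u)) + _ + _")
proof -
  let ?M = "4 * L"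
  define A where "A = (\<lambda>((a, b, c), x, y, z). {\<psi> (pos L a x), \<psi> (pos L b y), \<psi> (pos L c z)}) ` (SIGMA u:crossing s. ?R u)"
  define B1 where "B1 = (\<lambda>(x, y, z). {\<psi> x, \<psi> y, \<psi> z}) ` ({4 * s * L..<n} \<times> {..<n} \<times> {..<n})"
  \<comment> \<open>The second vertex is given by its offset \<open>r\<close> in the interval of
    \<open>x\<close>, which leaves only \<open>4 * L\<close> possibilities for it.\<close>
  define B2 where "B2 = (\<lambda>(x, r, z). {\<psi> x, \<psi> (?M * (x div ?M) + r), \<psi> z}) ` ({..<n} \<times> {..<?M} \<times> {..<n})"
  have finR: "finite (?R u)" for u
  proof -
    have "?R u \<subseteq> {..<L} \<times> {..<L} \<times> {..<L}" by (cases u) auto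
    then show ?thesis by (rule finite_subset) auto
  qed
  have "edges H \<subseteq> A \<union> (B1 \<union> B2)"
  proof
    fix e assume e: "e \<in> edges H"
    then have eV: "e \<subseteq> verts H" and e3: "card e = 3" using H by (auto simp: three_graph_def)
    obtain e' where ee': "e = \<psi> ` e'" and e'n: "e' \<subseteq> {..<n}"
      using eV bij_betw_imp_surj_on[OF \<psi>] by (metis subset_imageE)
    have "inj_on \<psi> e'" using \<psi> e'n by (meson bij_betw_def inj_on_subset)
    then have "card e' = 3" using e3 ee' card_image by metis
    then obtain x y z where xyz: "e' = {x, y, z}" "x < y" "y < z"
      using card_3_sorted by blast
    have e_eq: "e = {\<psi> x, \<psi> y, \<psi> z}" using ee' xyz by simp
    have n: "x < n" "y < n" "z < n" using e'n xyz by auto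
    have B2I: "{\<psi> p, \<psi> p', \<psi> r} \<in> B2" if "p < n" "r < n" "p div ?M = p' div ?M" for p p' r
      unfolding B2_def using that L
      by (intro image_eqI[of _ _ "(p, p' mod ?M, r)"]) auto
    show "e \<in> A \<union> (B1 \<union> B2)"
    proof (cases "4 * s * L \<le> z")
      case True
      then have "e \<in> B1" unfolding B1_def e_eq using n by (intro image_eqI[of _ _ "(z, x, y)"]) auto
      then show ?thesis by simp
    next
      case False
      consider "x div ?M = y div ?M" | "y div ?M = z div ?M" | "x div ?M < y div ?M" "y div ?M < z div ?M"
        using xyz by (meson div_le_mono le_neq_implies_less less_imp_le)
      then show ?thesis
      proof cases
        case 1
        then show ?thesis using B2I[of x z y] n by (simp add: e_eq)
      next
        case 2
        then show ?thesis using B2I[of y x z] n by (simp add: e_eq insert_commute)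
      next
        case 3
        have less: "x < 4 * s * L" "y < 4 * s * L" "z < 4 * s * L" using False xyz by auto
        obtain a x' where a: "a < 4 * s" "x' < L" "pos L a x' = x" "a div 4 = x div ?M" using pos_surj[OF less(1)] .
        obtain b y' where b: "b < 4 * s" "y' < L" "pos L b y' = y" "b div 4 = y div ?M" using pos_surj[OF less(2)] .
        obtain c z' where c: "c < 4 * s" "z' < L" "pos L c z' = z" "c div 4 = z div ?M" using pos_surj[OF less(3)] .
        have "((a, b, c), x', y', z') \<in> (SIGMA u:crossing s. ?R u)"
          using a b c 3 e by (simp add: crossing_def e_eq)
        then have "e \<in> A" unfolding A_def e_eq using a b c by (intro image_eqI[of _ _ "((a, b, c), x', y', z')"]) auto
        then show ?thesis by simp
      qed
    qed
  qed
  moreover have fins: "finite A" "finite B1" "finite B2"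
    unfolding A_def B1_def B2_def using finite_crossing finR by (intro finite_imageI finite_SigmaI; simp)+
  ultimately have "card (edges H) \<le> card (A \<union> (B1 \<union> B2))" by (intro card_mono) auto
  also have "\<dots> \<le> card A + (card B1 + card B2)" by (meson card_Un_le add_left_mono order_trans)
  also have "card A \<le> (\<Sum>u\<in>crossing s. card (?R u))"
    unfolding A_def using finite_crossing finR
    by (intro order_trans[OF card_image_le]) (auto simp: card_SigmaI intro!: finite_SigmaI)
  also have "card B1 \<le> (n - 4 * s * L) * n\<^sup>2"
    unfolding B1_def by (intro order_trans[OF card_image_le]) (auto simp: card_cartesian_product power2_eq_square)
  also have "card B2 \<le> 4 * L * n\<^sup>2"
    unfolding B2_def by (intro order_trans[OF card_image_le]) (auto simp: card_cartesian_product power2_eq_square)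
  finally show ?thesis by simp
qed

section \<open>Exchanging tiles inside a blow-up\<close>

text \<open>The old tiles that meet the blow-up are replaced by its \<open>J\<close> tiles. The
  blow-up uses \<open>t\<close> blocks of each interval, and only intervals that start before block
  \<open>card T\<close> contain old tiles, so the hypothesis \<open>J\<close> says that fewer than
  \<open>J\<close> tiles are lost.\<close>

lemma improve_tiling:
  fixes \<psi> :: "nat \<Rightarrow> 'a"
  assumes H: "three_graph H" and T: "Y32_tiling H T"
    and \<psi>: "bij_betw \<psi> {..<n} (verts H)" and g: "bij_betw g {..<card T} T"
    and n: "4 * card T \<le> n" and gverts: "\<And>i. i < card T \<Longrightarrow> verts (g i) = \<psi> ` {4 * i..<4 * i + 4}"
    and L: "4 * s * L \<le> n"
    and A: "\<And>i. i < s \<Longrightarrow> A i \<subseteq> {..<L} \<and> card (A i) = t" and t: "0 < t"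
    and K: "K \<subseteq> crossing s"
    and edge: "\<And>a b c x. \<lbrakk>(a, b, c) \<in> K; x \<in> PiE {..<s} A\<rbrakk> \<Longrightarrow>
      {\<psi> (pos L a (x (a div 4))), \<psi> (pos L b (x (b div 4))), \<psi> (pos L c (x (c div 4)))} \<in> edges H"
    and f: "\<And>j. j < J \<Longrightarrow> f j \<in> pattern_tiles K"
    and load: "\<And>q. q < 4 * s \<Longrightarrow> (\<Sum>j<J. tile_mult (f j) q) \<le> t"
    and J: "card {i. i < s \<and> i * L < card T} * t < J"
  shows "\<exists>T'. Y32_tiling H T' \<and> card T < card T'"
proof -
  let ?k = "card T"
  have div4: "q div 4 < s" if "q < 4 * s" for q
    using that by (simp add: div_less_iff_less_mult mult.commute)
  have "\<exists>h. bij_betw h {..<t} (A i)" if "i < s" for i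
    using A[OF that] ex_bij_betw_nat_finite[of "A i"] t
    by (metis card.infinite lessThan_atLeast0 less_irrefl)
  then obtain h where h: "\<And>i. i < s \<Longrightarrow> bij_betw (h i) {..<t} (A i)" by metis
  have hA: "h i l \<in> A i" if "i < s" "l < t" for i l
    using h[OF that(1)] that(2) by (auto simp: bij_betw_def)
  then have hL: "h i l < L" if "i < s" "l < t" for i l using A that by blast
  define \<phi> where "\<phi> q l = \<psi> (pos L q (h (q div 4) l))" for q l
  have \<psi>inj: "p = p'" if "p < n" "p' < n" "\<psi> p = \<psi> p'" for p p'
    using \<psi> that by (auto simp: bij_betw_def inj_on_def)
  have inj: "q = q' \<and> l = l'" if ql: "q < 4 * s" "l < t" "q' < 4 * s" "l' < t" "\<phi> q l = \<phi> q' l'" for q l q' l'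
  proof -
    have "pos L q (h (q div 4) l) = pos L q' (h (q' div 4) l')"
      using ql L by (intro \<psi>inj pos_less[of _ s] hL div4) (auto simp: \<phi>_def)
    then have *: "q = q' \<and> h (q div 4) l = h (q' div 4) l'"
      by (rule pos_inj[rotated 2]) (use ql in \<open>auto intro: hL div4\<close>)
    then have "h (q div 4) l = h (q div 4) l'" by metis
    then have "l = l'"
      using h[OF div4[OF ql(1)]] ql by (auto simp: bij_betw_def inj_on_def)
    with * show ?thesis by simp
  qed
  have copies: "{\<phi> a x, \<phi> b y, \<phi> c z} \<in> edges H" if abc: "(a, b, c) \<in> K" and xyz: "x < t" "y < t" "z < t" for a b c x y z
  proof -
    have cr: "a div 4 < b div 4" "b div 4 < c div 4" "c < 4 * s" using K abc by (auto simp: crossing_def)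
    then have s: "a div 4 < s" "b div 4 < s" "c div 4 < s" using div4[OF cr(3)] by simp_all
    define u where "u i = (if i = a div 4 then h i x else if i = b div 4 then h i y else if i = c div 4 then h i z
      else if i < s then h i 0 else undefined)" for i
    have "u \<in> PiE {..<s} A"
      using hA t xyz s by (auto simp: u_def PiE_iff extensional_def)
    from edge[OF abc this] show ?thesis using cr by (simp add: u_def \<phi>_def)
  qed
  have K': "K \<subseteq> sorted_triples (4 * s)" by (rule order_trans[OF K crossing_sorted])
  have "\<exists>T1. Y32_tiling H T1 \<and> card T1 = J \<and> covered T1 \<subseteq> {\<phi> q l |q l. q < 4 * s \<and> l < t}"
    by (rule tiling_of_blowup[where K = K and f = f]; (rule H inj copies f load K'; assumption))
  then obtain T1 where T1: "Y32_tiling H T1" "card T1 = J" "covered T1 \<subseteq> {\<phi> q l |q l. q < 4 * s \<and> l < t}"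
    by (elim exE conjE)
  \<comment> \<open>The numbers of the blocks touched by the blow-up; old tile \<open>i\<close> is
    block \<open>i\<close>, so it survives exactly if \<open>i\<close> is not in
    \<open>D\<close>.\<close>
  define D where "D = (\<Union>i<s. (\<lambda>x. i * L + x) ` A i)"
  define T0 where "T0 = g ` ({..<?k} - D)"
  have T0T: "T0 \<subseteq> T" using g by (auto simp: T0_def bij_betw_def)
  have finT: "finite T" by (rule Y32_tiling_props(1)[OF H T])
  have disj: "verts G \<inter> verts G' = {}" if GG: "G \<in> T0" "G' \<in> T1" for G G'
  proof (rule ccontr)
    assume "verts G \<inter> verts G' \<noteq> {}"
    then obtain v where v: "v \<in> verts G" "v \<in> verts G'" by blast
    obtain i where i: "i < ?k" "i \<notin> D" "G = g i" using GG(1) by (auto simp: T0_def)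
    obtain p where p: "4 * i \<le> p" "p < 4 * i + 4" "v = \<psi> p" using v(1) gverts[OF i(1)] i(3) by auto
    have "v \<in> covered T1" using v(2) GG(2) by (auto simp: covered_def)
    then obtain q l where ql: "q < 4 * s" "l < t" "v = \<phi> q l" using T1(3) by blast
    have "p = pos L q (h (q div 4) l)"
      using ql p i n L by (intro \<psi>inj pos_less[of _ s] hL div4) (auto simp: \<phi>_def)
    then have "p div 4 = (q div 4) * L + h (q div 4) l" by (simp add: pos_div)
    moreover have "p div 4 = i" using p by (intro div_nat_eqI) auto
    ultimately have "i = (q div 4) * L + h (q div 4) l" by simp
    then have "i \<in> D" unfolding D_def using ql div4 hA
      by (intro UN_I[of "q div 4"] image_eqI[of _ _ "h (q div 4) l"]) auto
    with i show False by simp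
  qed
  have tiling: "Y32_tiling H (T0 \<union> T1)"
    unfolding Y32_tiling_def
  proof
    show "\<forall>G\<in>T0 \<union> T1. is_Y32 G \<and> subhypergraph G H"
      using T T1(1) T0T by (auto simp: Y32_tiling_def)
    have "disjoint_family_on verts T" "disjoint_family_on verts T1"
      using T T1(1) by (auto simp: Y32_tiling_def)
    then show "disjoint_family_on verts (T0 \<union> T1)"
      unfolding disjoint_family_on_def
    proof (intro ballI impI)
      fix G G'
      assume *: "\<forall>m\<in>T. \<forall>n\<in>T. m \<noteq> n \<longrightarrow> verts m \<inter> verts n = {}" "\<forall>m\<in>T1. \<forall>n\<in>T1. m \<noteq> n \<longrightarrow> verts m \<inter> verts n = {}"
        and GG: "G \<in> T0 \<union> T1" "G' \<in> T0 \<union> T1" "G \<noteq> G'"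
      consider "G \<in> T" "G' \<in> T" | "G \<in> T1" "G' \<in> T1" | "G \<in> T0" "G' \<in> T1" | "G \<in> T1" "G' \<in> T0"
        using GG T0T by blast
      then show "verts G \<inter> verts G' = {}"
        by cases (use * GG(3) disj in blast)+
    qed
  qed
  have "T0 \<inter> T1 = {}"
  proof (rule ccontr)
    assume "T0 \<inter> T1 \<noteq> {}"
    then obtain G where G: "G \<in> T0" "G \<in> T1" by blast
    then have "verts G = {}" using disj by blast
    moreover have "card (verts G) = 4" using G(2) T1(1) by (intro card_verts_Y32(1)) (simp add: Y32_tiling_def)
    ultimately show False by simp
  qed
  then have card: "card (T0 \<union> T1) = card T0 + J"
    using T1(2) finT T0T Y32_tiling_props(1)[OF H T1(1)] by (simp add: card_Un_disjoint finite_subset)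
  have "inj_on g ({..<?k} - D)" using g by (auto simp: bij_betw_def intro: inj_on_subset)
  then have "card T0 = card ({..<?k} - D)" by (simp add: T0_def card_image)
  then have "?k \<le> card T0 + card ({..<?k} \<inter> D)"
    by (metis card_lessThan card_Diff_subset_Int card_Int_Diff finite_lessThan add.commute order_refl)
  moreover have "card ({..<?k} \<inter> D) \<le> card {i. i < s \<and> i * L < ?k} * t"
  proof -
    have fin: "finite {i. i < s \<and> i * L < ?k}" by simp
    have finA: "finite (A i)" if "i < s" for i using A[OF that] finite_subset by blast
    have "{..<?k} \<inter> D \<subseteq> (\<Union>i\<in>{i. i < s \<and> i * L < ?k}. (\<lambda>x. i * L + x) ` A i)"
      by (force simp: D_def)
    then have "card ({..<?k} \<inter> D) \<le> card (\<Union>i\<in>{i. i < s \<and> i * L < ?k}. (\<lambda>x. i * L + x) ` A i)"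
      using finA by (intro card_mono) auto
    also have "\<dots> \<le> (\<Sum>i\<in>{i. i < s \<and> i * L < ?k}. card ((\<lambda>x. i * L + x) ` A i))"
      by (rule card_UN_le[OF fin])
    also have "\<dots> \<le> (\<Sum>i\<in>{i. i < s \<and> i * L < ?k}. t)"
    proof (intro sum_mono)
      fix i assume "i \<in> {i. i < s \<and> i * L < ?k}"
      then have i: "i < s" by simp
      show "card ((\<lambda>x. i * L + x) ` A i) \<le> t"
        using card_image_le[OF finA[OF i], of "\<lambda>x. i * L + x"] A[OF i] by simp
    qed
    finally show ?thesis by simp
  qed
  ultimately have "?k < card (T0 \<union> T1)" using J card by linarith
  with tiling show ?thesis by blast
qed

text \<open>Every grid point selects one block per interval and thereby a pattern; a popular dense
  pattern contains a box of grid points. In the edge hypothesis, \<open>4 * s * n^2\<close> pays for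
  edges meeting the at most \<open>4 * s\<close> leftover positions, and \<open>n^3 / s\<close> for
  edges with two vertices in one interval.\<close>

lemma dense_blowup:
  fixes F \<delta> :: real
  assumes F: "0 \<le> F" and \<delta>: "0 < \<delta>" and s: "3 \<le> s"
  shows "\<exists>n0. \<forall>n\<ge>n0. \<forall>(H :: 'a hypergraph) \<psi>. three_graph H \<longrightarrow> bij_betw \<psi> {..<n} (verts H) \<longrightarrow>
    real n ^ 3 * (F / 6 + \<delta>) + real n ^ 3 / real s + 4 * real s * real n ^ 2 \<le> real (card (edges H)) \<longrightarrow>
    (\<exists>K A. K \<subseteq> crossing s \<and> real (4 * s) ^ 3 * F < 6 * real (card K) \<and>
      (\<forall>i<s. A i \<subseteq> {..<n div (4 * s)} \<and> card (A i) = t) \<and>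
      (\<forall>a b c x. (a, b, c) \<in> K \<longrightarrow> x \<in> PiE {..<s} A \<longrightarrow>
        {\<psi> (pos (n div (4 * s)) a (x (a div 4))), \<psi> (pos (n div (4 * s)) b (x (b div 4))),
         \<psi> (pos (n div (4 * s)) c (x (c div 4)))} \<in> edges H))"
proof -
  let ?m = "real (4 * s)"
  \<comment> \<open>The proportion of grid points that \<open>popular_value\<close> guarantees for
    one pattern.\<close>
  define c where "c = ?m ^ 3 * \<delta> / (real (card (crossing s) + 1) * 2 ^ card (crossing s))"
  have "0 < c" using \<delta> s by (auto simp: c_def intro!: divide_pos_pos mult_pos_pos)
  then obtain L0 where L0: "\<forall>L\<ge>L0. \<forall>E \<subseteq> grid s L. c * real L ^ s \<le> real (card E) \<longrightarrow>
    (\<exists>A. (\<forall>i<s. A i \<subseteq> {..<L} \<and> card (A i) = t) \<and> PiE {..<s} A \<subseteq> E)"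
    by (rule exE[OF dense_grid_has_box])
  have "\<exists>K A. K \<subseteq> crossing s \<and> real (4 * s) ^ 3 * F < 6 * real (card K) \<and>
      (\<forall>i<s. A i \<subseteq> {..<n div (4 * s)} \<and> card (A i) = t) \<and>
      (\<forall>a b c x. (a, b, c) \<in> K \<longrightarrow> x \<in> PiE {..<s} A \<longrightarrow>
        {\<psi> (pos (n div (4 * s)) a (x (a div 4))), \<psi> (pos (n div (4 * s)) b (x (b div 4))),
         \<psi> (pos (n div (4 * s)) c (x (c div 4)))} \<in> edges H)"
    if n: "4 * s * (L0 + 1) \<le> n" and H: "three_graph H" and \<psi>: "bij_betw \<psi> {..<n} (verts H)"
      and many: "real n ^ 3 * (F / 6 + \<delta>) + real n ^ 3 / real s + 4 * real s * real n ^ 2 \<le> real (card (edges H))"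
    for n and H :: "'a hypergraph" and \<psi>
  proof -
    define L where "L = n div (4 * s)"
    have L: "L0 + 1 \<le> L"
      unfolding L_def using n s by (subst less_eq_div_iff_mult_less_eq) (auto simp: mult.commute)
    have Ln: "4 * s * L \<le> n" by (simp add: L_def)
    have rem: "n - 4 * s * L \<le> 4 * s"
      using s by (simp add: L_def minus_mult_div_eq_mod less_imp_le)
    define P where "P a b c u v w \<longleftrightarrow> {\<psi> (pos L a u), \<psi> (pos L b v), \<psi> (pos L c w)} \<in> edges H" for a b c u v w
    define K where "K x = {(a, b, c). (a, b, c) \<in> crossing s \<and> P a b c (x (a div 4)) (x (b div 4)) (x (c div 4))}" for x
    define R where "R = (\<lambda>(a, b, c). {(x, y, z). x < L \<and> y < L \<and> z < L \<and> P a b c x y z})"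
    have K_sub: "K x \<subseteq> crossing s" for x by (auto simp: K_def)
    have "(\<Sum>x\<in>grid s L. card (K x)) = (\<Sum>x\<in>grid s L. \<Sum>u\<in>crossing s. of_bool (u \<in> K x))"
      using K_sub finite_crossing[of s] by (intro sum.cong) (simp_all add: Int_absorb1)
    also have "\<dots> = (\<Sum>u\<in>crossing s. \<Sum>x\<in>grid s L. of_bool (u \<in> K x))" by (rule sum.swap)
    \<comment> \<open>For a fixed crossing triple the pattern depends on three distinct coordinates
      only, so each edge in \<open>R u\<close> occurs for \<open>L ^ (s - 3)\<close> grid
      points.\<close>
    also have "\<dots> = (\<Sum>u\<in>crossing s. card (R u) * L ^ (s - 3))"
    proof (rule sum.cong)
      fix u assume u: "u \<in> crossing s"
      obtain a b c where abc: "u = (a, b, c)" by (cases u)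
      have "a div 4 < b div 4" "b div 4 < c div 4" "c div 4 < s"
        using u by (auto simp: abc crossing_def div_less_iff_less_mult mult.commute)
      then have "card {x \<in> grid s L. P a b c (x (a div 4)) (x (b div 4)) (x (c div 4))} = card (R u) * L ^ (s - 3)"
        by (simp add: R_def abc card_grid_three_coordinates)
      moreover have "(\<Sum>x\<in>grid s L. of_bool (u \<in> K x)) = card {x \<in> grid s L. P a b c (x (a div 4)) (x (b div 4)) (x (c div 4))}"
        using u by (simp add: K_def abc Int_def)
      ultimately show "(\<Sum>x\<in>grid s L. of_bool (u \<in> K x)) = card (R u) * L ^ (s - 3)" by simp
    qed simp
    finally have sumK: "(\<Sum>x\<in>grid s L. card (K x)) = (\<Sum>u\<in>crossing s. card (R u)) * L ^ (s - 3)"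
      by (simp add: sum_distrib_right)
    have "card (edges H) \<le> (\<Sum>u\<in>crossing s. card (R u)) + (n - 4 * s * L) * n\<^sup>2 + 4 * L * n\<^sup>2"
      using card_edges_le_crossing[OF H \<psi> _ Ln] L by (simp add: R_def P_def)
    also have "\<dots> \<le> (\<Sum>u\<in>crossing s. card (R u)) + 4 * s * n\<^sup>2 + 4 * L * n\<^sup>2"
      using rem by simp
    finally have "real (card (edges H)) \<le> real ((\<Sum>u\<in>crossing s. card (R u)) + 4 * s * n\<^sup>2 + 4 * L * n\<^sup>2)"
      by (simp only: of_nat_le_iff)
    then have e: "real (card (edges H)) \<le> real (\<Sum>u\<in>crossing s. card (R u)) + 4 * real s * real n ^ 2 + real (4 * L) * real n ^ 2"
      by simp
    have "real (s * (4 * L)) \<le> real n" using Ln by (simp only: of_nat_le_iff mult_ac)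
    then have "real (4 * L) \<le> real n / real s" using s by (simp add: field_simps)
    then have "real (4 * L) * real n ^ 2 \<le> real n ^ 3 / real s"
      using mult_right_mono[of "real (4 * L)" "real n / real s" "real n ^ 2"] by (simp add: power2_eq_square power3_eq_cube)
    with e many have "real n ^ 3 * (F / 6 + \<delta>) \<le> real (\<Sum>u\<in>crossing s. card (R u))" by linarith
    moreover have "(?m * real L) ^ 3 * (F / 6 + \<delta>) \<le> real n ^ 3 * (F / 6 + \<delta>)"
    proof (intro mult_right_mono power_mono)
      have "real (4 * s * L) \<le> real n" using Ln by (simp only: of_nat_le_iff)
      then show "?m * real L \<le> real n" by simp
    qed (use F \<delta> in auto)
    ultimately have "(?m ^ 3 * F / 6 + ?m ^ 3 * \<delta>) * real L ^ 3 \<le> real (\<Sum>u\<in>crossing s. card (R u))"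
      by (simp add: power_mult_distrib algebra_simps)
    then have "(?m ^ 3 * F / 6 + ?m ^ 3 * \<delta>) * real L ^ 3 * real L ^ (s - 3) \<le> real (\<Sum>u\<in>crossing s. card (R u)) * real L ^ (s - 3)"
      by (rule mult_right_mono) simp
    also have "real L ^ 3 * real L ^ (s - 3) = real L ^ s" using s by (simp add: power_add[symmetric])
    then have "(?m ^ 3 * F / 6 + ?m ^ 3 * \<delta>) * real L ^ 3 * real L ^ (s - 3) = (?m ^ 3 * F / 6 + ?m ^ 3 * \<delta>) * real (card (grid s L))"
      by (simp add: mult.assoc)
    also have "real (\<Sum>u\<in>crossing s. card (R u)) * real L ^ (s - 3) = (\<Sum>x\<in>grid s L. real (card (K x)))"
      using arg_cong[OF sumK, of real] by simp
    finally have avg: "(?m ^ 3 * F / 6 + ?m ^ 3 * \<delta>) * real (card (grid s L)) \<le> (\<Sum>x\<in>grid s L. real (card (K x)))" .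
    have ne: "grid s L \<noteq> {}" using L by (simp add: PiE_eq_empty_iff lessThan_empty_iff)
    obtain K0 where K0: "K0 \<subseteq> crossing s" "?m ^ 3 * F / 6 < real (card K0)"
      "c * real (card (grid s L)) \<le> real (card {x \<in> grid s L. K x = K0})"
      using popular_value[OF finite_grid finite_crossing K_sub avg] F \<delta> s ne unfolding c_def by auto
    have "L0 \<le> L" "{x \<in> grid s L. K x = K0} \<subseteq> grid s L" "c * real L ^ s \<le> real (card {x \<in> grid s L. K x = K0})"
      using L K0(3) by auto
    from L0[rule_format, OF this] obtain A where A: "\<forall>i<s. A i \<subseteq> {..<L} \<and> card (A i) = t"
      "PiE {..<s} A \<subseteq> {x \<in> grid s L. K x = K0}" by (elim exE conjE)
    have "P a b c (x (a div 4)) (x (b div 4)) (x (c div 4))" if "(a, b, c) \<in> K0" "x \<in> PiE {..<s} A" for a b c x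
    proof -
      have "K x = K0" using A(2) that(2) by blast
      with that(1) have "(a, b, c) \<in> K x" by simp
      then show ?thesis by (simp add: K_def)
    qed
    with K0 A(1) show ?thesis
      unfolding L_def[symmetric] P_def by (intro exI[of _ K0] exI[of _ A]) auto
  qed
  then show ?thesis by blast
qed

section \<open>The threshold\<close>

lemma gchoose_3: "(x :: real) gchoose 3 = (x ^ 3 - 3 * x\<^sup>2 + 2 * x) / 6"
  by (simp add: gbinomial_prod_rev numeral_3_eq_3 power2_eq_square algebra_simps)

text \<open>The right side of \<open>heavy_prob_bound\<close>, and also the limit of six times the
  edge threshold divided by \<open>n^3\<close>.\<close>

definition density :: "real \<Rightarrow> real" where
  "density \<beta> = max (64 * \<beta> ^ 3) (1 - (1 - \<beta>) ^ 3)"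

lemma density_nonneg: "0 \<le> \<beta> \<Longrightarrow> 0 \<le> density \<beta>"
  by (simp add: density_def le_max_iff_disj)

text \<open>Both functions in the maximum have slope below 48 on this range, so raising \<alpha> by
  \<open>\<gamma> / 48\<close> costs at most \<gamma>.\<close>

lemma density_shift:
  assumes "0 \<le> \<alpha>" "\<alpha> \<le> 1 / 4" "0 \<le> \<epsilon>" "\<epsilon> \<le> 1 / 100"
  shows "density (\<alpha> + \<epsilon>) \<le> density \<alpha> + 48 * \<epsilon>"
proof -
  have "64 * (\<alpha> + \<epsilon>) ^ 3 - 64 * \<alpha> ^ 3 = 64 * \<epsilon> * (3 * \<alpha> * \<alpha> + 3 * \<alpha> * \<epsilon> + \<epsilon> * \<epsilon>)"
    by (simp add: power3_eq_cube algebra_simps)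
  also have "\<dots> \<le> 64 * \<epsilon> * (3 * (1/4) * (1/4) + 3 * (1/4) * (1/100) + (1/100) * (1/100))"
    using assms by (intro mult_left_mono add_mono mult_mono) auto
  also have "\<dots> \<le> 48 * \<epsilon>" using assms by simp
  finally have 1: "64 * (\<alpha> + \<epsilon>) ^ 3 \<le> 64 * \<alpha> ^ 3 + 48 * \<epsilon>" by simp
  have "(1 - \<alpha>) ^ 3 - (1 - (\<alpha> + \<epsilon>)) ^ 3
      = \<epsilon> * ((1 - \<alpha>) * (1 - \<alpha>) + (1 - \<alpha>) * (1 - (\<alpha> + \<epsilon>)) + (1 - (\<alpha> + \<epsilon>)) * (1 - (\<alpha> + \<epsilon>)))"
    by (simp add: power3_eq_cube algebra_simps)
  also have "\<dots> \<le> \<epsilon> * (1 * 1 + 1 * 1 + 1 * 1)"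
    using assms by (intro mult_left_mono add_mono mult_mono) auto
  finally have 2: "1 - (1 - (\<alpha> + \<epsilon>)) ^ 3 \<le> 1 - (1 - \<alpha>) ^ 3 + 48 * \<epsilon>" using assms by simp
  show ?thesis using 1 2 unfolding density_def by linarith
qed

text \<open>The binomial polynomials differ from \<open>x^3 / 6\<close> in lower order terms only,
  and for arguments between 0 and \<open>n\<close> these are absorbed by \<open>n^2\<close>.\<close>

lemma threshold_ge_density:
  fixes \<alpha> :: real
  assumes "0 \<le> \<alpha>" "\<alpha> \<le> 1 / 4"
  shows "real n ^ 3 * density \<alpha> / 6 - real n ^ 2
    \<le> max ((4 * \<alpha> * real n) gchoose 3) (real (n choose 3) - ((real n - \<alpha> * real n) gchoose 3))"
proof -
  define X where "X = 4 * \<alpha> * real n"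
  define Z where "Z = real n - \<alpha> * real n"
  have X: "0 \<le> X" "X \<le> real n" using assms by (auto simp: X_def intro: mult_left_le_one_le)
  have Z: "0 \<le> Z" "Z \<le> real n" using assms by (auto simp: Z_def mult_left_le_one_le)
  have "X\<^sup>2 \<le> (real n)\<^sup>2" using X by (intro power_mono)
  then have "X ^ 3 / 6 - real n ^ 2 \<le> X gchoose 3"
    using X(1) zero_le_power2[of "real n"] unfolding gchoose_3 add_divide_distrib diff_divide_distrib by linarith
  moreover have "X ^ 3 = real n ^ 3 * (64 * \<alpha> ^ 3)" by (simp add: X_def power_mult_distrib mult_ac)
  ultimately have 1: "real n ^ 3 * (64 * \<alpha> ^ 3) / 6 - real n ^ 2 \<le> X gchoose 3" by simp
  have "0 \<le> Z\<^sup>2" by simp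
  then have "real n ^ 3 / 6 - Z ^ 3 / 6 - real n ^ 2 \<le> real (n choose 3) - (Z gchoose 3)"
    using Z zero_le_power2[of "real n"]
    unfolding binomial_gbinomial gchoose_3 add_divide_distrib diff_divide_distrib by linarith
  moreover have "Z ^ 3 = real n ^ 3 * (1 - \<alpha>) ^ 3"
    by (simp add: Z_def power_mult_distrib[symmetric] algebra_simps)
  ultimately have 2: "real n ^ 3 * (1 - (1 - \<alpha>) ^ 3) / 6 - real n ^ 2 \<le> real (n choose 3) - (Z gchoose 3)"
    by (simp add: right_diff_distrib diff_divide_distrib)
  show ?thesis
    using 1 2 unfolding X_def[symmetric] Z_def[symmetric] density_def max_def by auto
qed

text \<open>The pattern is tiled at the slightly larger rate \<beta>, so the new tiles of the
  blow-up outnumber the old ones it meets. The constants only have to make this gain exceed the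
  rounding errors.\<close>

lemma larger_tiling_exists:
  fixes \<alpha> \<gamma> :: real
  assumes \<alpha>: "0 < \<alpha>" "\<alpha> < 1 / 4" and \<gamma>: "0 < \<gamma>" "\<gamma> < 1 / 4"
  shows "\<exists>n0. \<forall>n\<ge>n0. \<forall>(H :: 'a hypergraph) T. three_graph H \<longrightarrow> card (verts H) = n \<longrightarrow>
    real n ^ 3 * density \<alpha> / 6 - real n ^ 2 + \<gamma> * real n ^ 3 \<le> real (card (edges H)) \<longrightarrow>
    Y32_tiling H T \<longrightarrow> real (card T) \<le> \<alpha> * real n \<longrightarrow> (\<exists>T'. Y32_tiling H T' \<and> card T < card T')"
proof -
  define \<beta> where "\<beta> = \<alpha> + \<gamma> / 48"
  \<comment> \<open>From \<open>36 \<le> \<gamma> * s\<close> follow both the loss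
    \<open>n^3 / s \<le> \<gamma> * n^3 / 36\<close> and a margin of 3 of \<open>B\<close> over
    \<open>4 * \<alpha> * s\<close>.\<close>
  define s where "s = nat \<lceil>36 / \<gamma>\<rceil> + 3"
  define m where "m = 4 * s"
  \<comment> \<open>With \<open>J = m * y^2\<close> the root of \<open>J * m\<close> is exactly
    \<open>m * y\<close>. The errors in \<open>tJ\<close> are at most \<open>3 * m^2 * y\<close>,
    and \<open>y > 3 * m^2\<close> puts them below \<open>y^2 = J / m \<le> J / B\<close>.\<close>
  define y where "y = 3 * m\<^sup>2 + 1"
  define J where "J = m * y\<^sup>2"
  define B where "B = \<beta> * real m"
  define t where "t = nat \<lceil>real J / B + 2 * (real m * real y)\<rceil>"
  have s3: "3 \<le> s" by (simp add: s_def)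
  have "36 / \<gamma> \<le> real s" unfolding s_def by linarith
  then have s\<gamma>: "36 \<le> \<gamma> * real s" using \<gamma> by (simp add: field_simps)
  have \<beta>: "0 < \<beta>" "\<beta> \<le> 1" using \<alpha> \<gamma> by (simp_all add: \<beta>_def)
  have Beq: "B = 4 * \<alpha> * real s + \<gamma> * real s / 12" by (simp add: B_def \<beta>_def m_def algebra_simps)
  then have B: "4 * \<alpha> * real s + 3 \<le> B" using s\<gamma> by simp
  have B3: "3 \<le> B" using B \<alpha> by (smt (verit) mult_nonneg_nonneg of_nat_0_le_iff)
  have Bm: "B \<le> real m" using \<beta> by (simp add: B_def mult_left_le_one_le)
  have m1: "1 \<le> real m" using s3 by (simp add: m_def)
  have y1: "1 \<le> real y" "3 * real m ^ 2 < real y" by (simp_all add: y_def)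
  have sqrt: "sqrt (real J * real m) = real m * real y"
    by (rule real_sqrt_unique) (simp_all add: J_def power2_eq_square)
  have t1: "real J / B + 2 * (real m * real y) \<le> real t" unfolding t_def by linarith
  have "0 \<le> real J / B + 2 * (real m * real y)" using B3 by simp
  then have t2: "real t \<le> real J / B + 2 * (real m * real y) + 1" unfolding t_def by linarith
  have "0 < 2 * (real m * real y)" using m1 y1 by simp
  then have t0: "0 < t" using t1 B3 by (smt (verit) divide_nonneg_pos of_nat_0_le_iff of_nat_0_less_iff)
  \<comment> \<open>As \<open>t\<close> is \<open>J / B\<close> up to errors,
    \<open>(B - 1) * t\<close> is \<open>J - J / B\<close> up to errors, and the choice of
    \<open>y\<close> keeps those below \<open>J / B\<close>.\<close>
  have tJ: "(B - 1) * real t < real J"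
  proof -
    have "(B - 1) * real t \<le> (B - 1) * (real J / B + 2 * (real m * real y) + 1)"
      using t2 B3 by (intro mult_left_mono) auto
    also have "\<dots> = real J - real J / B + (B - 1) * (2 * (real m * real y) + 1)"
      using B3 by (simp add: field_simps)
    also have "(B - 1) * (2 * (real m * real y) + 1) \<le> real m * (3 * (real m * real y))"
    proof (rule mult_mono)
      have "1 * 1 \<le> real m * real y" using m1 y1 by (intro mult_mono) auto
      then show "2 * (real m * real y) + 1 \<le> 3 * (real m * real y)" by simp
    qed (use Bm B3 m1 y1 in auto)
    also have "\<dots> = 3 * real m ^ 2 * real y" by (simp add: power2_eq_square)
    also have "\<dots> < real y * real y" using y1 by (intro mult_strict_right_mono) auto
    also have "real y * real y = real J / real m" using m1 by (simp add: J_def power2_eq_square)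
    also have "\<dots> \<le> real J / B" using Bm B3 by (intro divide_left_mono) auto
    finally show ?thesis by simp
  qed
  obtain n1 where n1: "\<forall>n\<ge>n1. \<forall>(H :: 'a hypergraph) \<psi>. three_graph H \<longrightarrow> bij_betw \<psi> {..<n} (verts H) \<longrightarrow>
    real n ^ 3 * (density \<beta> / 6 + \<gamma> / 2) + real n ^ 3 / real s + 4 * real s * real n ^ 2 \<le> real (card (edges H)) \<longrightarrow>
    (\<exists>K A. K \<subseteq> crossing s \<and> real (4 * s) ^ 3 * density \<beta> < 6 * real (card K) \<and>
      (\<forall>i<s. A i \<subseteq> {..<n div (4 * s)} \<and> card (A i) = t) \<and>
      (\<forall>a b c x. (a, b, c) \<in> K \<longrightarrow> x \<in> PiE {..<s} A \<longrightarrow>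
        {\<psi> (pos (n div (4 * s)) a (x (a div 4))), \<psi> (pos (n div (4 * s)) b (x (b div 4))),
         \<psi> (pos (n div (4 * s)) c (x (c div 4)))} \<in> edges H))"
    by (rule exE[OF dense_blowup[of "density \<beta>" "\<gamma> / 2" s t]]) (use density_nonneg \<beta> \<gamma> s3 in auto)
  define n0 where "n0 = n1 + 4 * s * (s + 1) + nat \<lceil>4 * (4 * real s + 1) / \<gamma>\<rceil>"
  have "\<exists>T'. Y32_tiling H T' \<and> card T < card T'"
    if n: "n0 \<le> n" and H: "three_graph H" and V: "card (verts H) = n"
      and many: "real n ^ 3 * density \<alpha> / 6 - real n ^ 2 + \<gamma> * real n ^ 3 \<le> real (card (edges H))"
      and T: "Y32_tiling H T" and kn: "real (card T) \<le> \<alpha> * real n"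
    for n and H :: "'a hypergraph" and T
  proof -
    define L where "L = n div (4 * s)"
    have Ln: "4 * s * L \<le> n" by (simp add: L_def)
    have sL: "s \<le> L"
      unfolding L_def using n s3 by (subst less_eq_div_iff_mult_less_eq) (auto simp: n0_def algebra_simps)
    have nL: "n \<le> 4 * s * L + 4 * s"
    proof -
      have "n mod (4 * s) < 4 * s" using s3 by simp
      then show ?thesis unfolding L_def by (metis add_le_cancel_left less_imp_le mult_div_mod_eq)
    qed
    have "4 * (4 * real s + 1) / \<gamma> \<le> real n" using n unfolding n0_def by linarith
    then have n\<gamma>: "4 * (4 * real s + 1) \<le> \<gamma> * real n" using \<gamma> by (simp add: field_simps)
    \<comment> \<open>The budget of \<open>\<gamma> * n^3\<close>: 1/6 for the passage from \<alpha>
      to \<beta>, 1/2 for the margin, 1/36 for \<open>n^3 / s\<close> and 1/4 for the quadratic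
      terms, in total 34/36.\<close>
    have dens: "real n ^ 3 * (density \<beta> / 6 + \<gamma> / 2) + real n ^ 3 / real s + 4 * real s * real n ^ 2 \<le> real (card (edges H))"
    proof -
      have "density \<beta> \<le> density \<alpha> + \<gamma>" using density_shift[of \<alpha> "\<gamma> / 48"] \<alpha> \<gamma> by (simp add: \<beta>_def)
      then have "real n ^ 3 * density \<beta> \<le> real n ^ 3 * (density \<alpha> + \<gamma>)" by (intro mult_left_mono) auto
      then have "real n ^ 3 * density \<beta> \<le> real n ^ 3 * density \<alpha> + \<gamma> * real n ^ 3" by (simp add: algebra_simps)
      moreover have "real n ^ 3 / real s \<le> (\<gamma> * real n ^ 3) / 36"
      proof -
        have "1 / real s \<le> \<gamma> / 36" using s\<gamma> s3 by (simp add: field_simps)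
        then show ?thesis using mult_left_mono[of "1 / real s" "\<gamma> / 36" "real n ^ 3"] by (simp add: mult.commute)
      qed
      moreover have "4 * (4 * real s + 1) * real n ^ 2 \<le> \<gamma> * real n * real n ^ 2"
        using n\<gamma> by (intro mult_right_mono) auto
      then have "4 * (4 * real s * real n ^ 2) + 4 * real n ^ 2 \<le> \<gamma> * real n ^ 3"
        by (simp add: power2_eq_square power3_eq_cube algebra_simps)
      moreover have "0 \<le> \<gamma> * real n ^ 3" using \<gamma> by simp
      moreover have "real n ^ 3 * (density \<beta> / 6 + \<gamma> / 2) = real n ^ 3 * density \<beta> / 6 + (\<gamma> * real n ^ 3) / 2"
        by (simp add: algebra_simps)
      ultimately show ?thesis using many by linarith
    qed
    obtain \<psi> g where \<psi>: "bij_betw \<psi> {..<n} (verts H)" and g: "bij_betw g {..<card T} T"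
      and k4: "4 * card T \<le> n" and gv: "\<forall>i<card T. verts (g i) = \<psi> ` {4 * i..<4 * i + 4}"
      using tiling_enumeration[OF H T] unfolding V by (elim exE conjE)
    have "n1 \<le> n" using n by (simp add: n0_def)
    from n1[rule_format, OF this H \<psi> dens] obtain K A where
      K: "K \<subseteq> crossing s" "real (4 * s) ^ 3 * density \<beta> < 6 * real (card K)"
      and A: "\<forall>i<s. A i \<subseteq> {..<L} \<and> card (A i) = t"
      and edge: "\<forall>a b c x. (a, b, c) \<in> K \<longrightarrow> x \<in> PiE {..<s} A \<longrightarrow>
        {\<psi> (pos L a (x (a div 4))), \<psi> (pos L b (x (b div 4))), \<psi> (pos L c (x (c div 4)))} \<in> edges H"
      unfolding L_def[symmetric] by (elim exE conjE)
    have "\<exists>f. (\<forall>j<J. f j \<in> pattern_tiles K) \<and> (\<forall>q<4 * s. (\<Sum>j<J. tile_mult (f j) q) \<le> t)"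
    proof (rule pattern_tile_sequence)
      show "K \<subseteq> sorted_triples (4 * s)" by (rule order_trans[OF K(1) crossing_sorted])
      show "real (4 * s) ^ 3 * max (64 * \<beta> ^ 3) (1 - (1 - \<beta>) ^ 3) < 6 * real (card K)"
        using K(2) by (simp only: density_def)
      show "1 \<le> \<beta> * real (4 * s)" using B3 by (simp add: B_def m_def)
      show "real J / (\<beta> * real (4 * s)) + 2 * sqrt (real J * real (4 * s)) \<le> real t"
        using t1 sqrt by (simp add: B_def m_def)
    qed
    then obtain f where f: "\<forall>j<J. f j \<in> pattern_tiles K" "\<forall>q<4 * s. (\<Sum>j<J. tile_mult (f j) q) \<le> t"
      by (elim exE conjE)
    \<comment> \<open>Old tiles are the first \<open>card T\<close> blocks, so at most
      \<open>card T div L + 1\<close> intervals contain any. This 1, a second one for the leftover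
      positions (using \<open>s \<le> L\<close>), and the 1 in \<open>B - 1\<close> make up the 3 by
      which \<open>B\<close> exceeds \<open>4 * \<alpha> * s\<close>.\<close>
    have J: "card {i. i < s \<and> i * L < card T} * t < J"
    proof -
      let ?r = "card {i. i < s \<and> i * L < card T}"
      have L0: "0 < L" using sL s3 by simp
      have "{i. i < s \<and> i * L < card T} \<subseteq> {..card T div L}"
        using L0 by (auto simp: less_eq_div_iff_mult_less_eq)
      from card_mono[OF _ this] have "?r \<le> card T div L + 1" by simp
      then have "real ?r \<le> real (card T div L) + 1" by simp
      also have "real (card T div L) \<le> real (card T) / real L" by (rule of_nat_div_le_of_nat)
      also have "\<dots> \<le> 4 * \<alpha> * real s + 1"
      proof -
        have "real (card T) \<le> \<alpha> * real (4 * s * L + 4 * s)"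
          using kn nL \<alpha> by (meson mult_left_mono less_imp_le of_nat_mono order_trans)
        also have "\<dots> = 4 * \<alpha> * real s * real L + (4 * \<alpha>) * real s" by (simp add: algebra_simps)
        finally have "real (card T) \<le> 4 * \<alpha> * real s * real L + (4 * \<alpha>) * real s" .
        moreover have "(4 * \<alpha>) * real s \<le> 1 * real L" using \<alpha> sL by (intro mult_mono) auto
        ultimately have "real (card T) \<le> (4 * \<alpha> * real s + 1) * real L" by (simp add: distrib_right)
        then show ?thesis using L0 by (simp add: pos_divide_le_eq)
      qed
      finally have "real ?r \<le> B - 1" using B by simp
      then have "real ?r * real t \<le> (B - 1) * real t" by (intro mult_right_mono) auto
      with tJ have "real (?r * t) < real J" by simp
      then show ?thesis by (simp only: of_nat_less_iff)
    qed
    show ?thesis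
    proof (rule improve_tiling[OF H T \<psi> g k4 _ Ln _ t0 K(1) _ _ _ J])
      show "verts (g i) = \<psi> ` {4 * i..<4 * i + 4}" if "i < card T" for i
        by (rule gv[rule_format, OF that])
      show "A i \<subseteq> {..<L} \<and> card (A i) = t" if "i < s" for i
        by (rule A[rule_format, OF that])
      show "{\<psi> (pos L a (x (a div 4))), \<psi> (pos L b (x (b div 4))), \<psi> (pos L c (x (c div 4)))} \<in> edges H"
        if "(a, b, c) \<in> K" "x \<in> PiE {..<s} A" for a b c x
        by (rule edge[rule_format, OF that])
      show "f j \<in> pattern_tiles K" if "j < J" for j
        by (rule f(1)[rule_format, OF that])
      show "(\<Sum>j<J. tile_mult (f j) q) \<le> t" if "q < 4 * s" for q
        by (rule f(2)[rule_format, OF that])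
    qed
  qed
  then have "\<forall>n\<ge>n0. \<forall>(H :: 'a hypergraph) T. three_graph H \<longrightarrow> card (verts H) = n \<longrightarrow>
    real n ^ 3 * density \<alpha> / 6 - real n ^ 2 + \<gamma> * real n ^ 3 \<le> real (card (edges H)) \<longrightarrow>
    Y32_tiling H T \<longrightarrow> real (card T) \<le> \<alpha> * real n \<longrightarrow> (\<exists>T'. Y32_tiling H T' \<and> card T < card T')"
    by (intro allI impI) assumption
  then show ?thesis by (rule exI)
qed

theorem theorem1p1:
  fixes \<alpha> \<gamma> :: real
  assumes "\<alpha> \<in> {0<..<1/4}" and "\<gamma> \<in> {0<..<1/4}"
  shows "\<exists>n\<^sub>0::nat. \<forall>n\<ge>n\<^sub>0. \<forall>H :: 'a hypergraph.
    three_graph H \<and> card (verts H) = n \<and>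
    real (card (edges H)) \<ge>
      max ((4 * \<alpha> * real n) gchoose 3)
          (real (n choose 3) - ((real n - \<alpha> * real n) gchoose 3)) + \<gamma> * real n ^ 3
    \<longrightarrow> (\<exists>T. Y32_tiling H T \<and> real (card (covered T)) > 4 * \<alpha> * real n)"
proof -
  have \<alpha>: "0 < \<alpha>" "\<alpha> < 1 / 4" and \<gamma>: "0 < \<gamma>" "\<gamma> < 1 / 4" using assms by auto
  obtain n0 where n0: "\<forall>n\<ge>n0. \<forall>(H :: 'a hypergraph) T. three_graph H \<longrightarrow> card (verts H) = n \<longrightarrow>
    real n ^ 3 * density \<alpha> / 6 - real n ^ 2 + \<gamma> * real n ^ 3 \<le> real (card (edges H)) \<longrightarrow>
    Y32_tiling H T \<longrightarrow> real (card T) \<le> \<alpha> * real n \<longrightarrow> (\<exists>T'. Y32_tiling H T' \<and> card T < card T')"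
    by (rule exE[OF larger_tiling_exists[OF \<alpha> \<gamma>]])
  show ?thesis
  proof (intro exI[of _ n0] allI impI, elim conjE)
    fix n and H :: "'a hypergraph"
    assume n: "n0 \<le> n" and H: "three_graph H" and V: "card (verts H) = n"
      and many: "real (card (edges H)) \<ge> max ((4 * \<alpha> * real n) gchoose 3)
          (real (n choose 3) - ((real n - \<alpha> * real n) gchoose 3)) + \<gamma> * real n ^ 3"
    have many': "real n ^ 3 * density \<alpha> / 6 - real n ^ 2 + \<gamma> * real n ^ 3 \<le> real (card (edges H))"
      using many threshold_ge_density[of \<alpha> n] \<alpha> by linarith
    have bounded: "card T \<le> n" if "Y32_tiling H T" for T
      using Y32_tiling_props[OF H that] card_mono[of "verts H" "covered T"] H V by (simp add: three_graph_def)
    have "Y32_tiling H {}" by (simp add: Y32_tiling_def disjoint_family_on_def)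
    \<comment> \<open>A largest tiling exists since sizes are bounded by \<open>n\<close>; it must
      have more than \<open>\<alpha> * n\<close> tiles, each covering four vertices.\<close>
    then have "\<exists>T. Y32_tiling H T \<and> (\<forall>T'. Y32_tiling H T' \<longrightarrow> card T' \<le> card T)"
    proof (rule Lattices_Big.ex_has_greatest_nat)
      show "\<forall>T. Y32_tiling H T \<longrightarrow> card T < Suc n" using bounded by (auto simp: less_Suc_eq_le)
    qed
    then obtain T where T: "Y32_tiling H T" and max: "\<forall>T'. Y32_tiling H T' \<longrightarrow> card T' \<le> card T"
      by (elim exE conjE)
    have "\<not> real (card T) \<le> \<alpha> * real n"
    proof
      assume "real (card T) \<le> \<alpha> * real n"
      from n0[rule_format, OF n H V many' T this] obtain T' where "Y32_tiling H T'" "card T < card T'"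
        by (elim exE conjE)
      with max show False by (meson not_le)
    qed
    then have "real (card (covered T)) > 4 * \<alpha> * real n"
      by (simp add: Y32_tiling_props(3)[OF H T])
    with T show "\<exists>T. Y32_tiling H T \<and> real (card (covered T)) > 4 * \<alpha> * real n" by blast
  qed
qed

end
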